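(* Let $m\ge2$ and let $\Omega$ be a bounded domain in $\mathbb{R}^{2m}$ with coordinates $(x_1,y_1,\dots,x_m,y_m)$. Let $\vec F=(-y_1,x_1,-y_2,x_2,\dots,-y_m,x_m)$. For $w\in C^1(\Omega)$ let $S(w)=\{p\in\Omega:(\nabla w+\vec F)(p)=0\}$ and on $\Omega\setminus S(w)$ let $N(w)=(\nabla w+\vec F)/|\nabla w+\vec F|$. Let $u,v\in C^{2}(\Omega)\cap C^{0}(\bar\Omega)$ and $S=S(u)\cup S(v)$. Suppose $\operatorname{div}N(u)\ge\operatorname{div}N(v)$ in $\Omega\setminus S$ and $u\le v$ on $\partial\Omega$. Then $u\le v$ in $\Omega$.
   Context: $\nabla$ and $\operatorname{div}$ are the Euclidean gradient and divergence in $\mathbb{R}^{2m}$. *)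

theory Defs
  imports "HOL-Analysis.Analysis"
begin

text \<open>Euclidean gradient of a real function on a Euclidean space
  (via its Frechet derivative); meaningful where the function is differentiable.\<close>
definition grad :: "('a::euclidean_space \<Rightarrow> real) \<Rightarrow> 'a \<Rightarrow> 'a" where
  "grad w p = (\<Sum>b\<in>Basis. frechet_derivative w (at p) b *\<^sub>R b)"

definition divergence :: "('a::euclidean_space \<Rightarrow> 'a) \<Rightarrow> 'a \<Rightarrow> real" where
  "divergence N p = (\<Sum>b\<in>Basis. frechet_derivative (\<lambda>q. N q \<bullet> b) (at p) b)"

definition C1_on :: "'a::euclidean_space set \<Rightarrow> ('a \<Rightarrow> real) \<Rightarrow> bool" where
  "C1_on \<Omega> w \<longleftrightarrow> (\<forall>p\<in>\<Omega>. w differentiable (at p)) \<and> continuous_on \<Omega> (grad w)"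

definition C2_on :: "'a::euclidean_space set \<Rightarrow> ('a \<Rightarrow> real) \<Rightarrow> bool" where
  "C2_on \<Omega> w \<longleftrightarrow> C1_on \<Omega> w \<and> (\<forall>b\<in>Basis. C1_on \<Omega> (\<lambda>p. grad w p \<bullet> b))"

text \<open>R^{2m} with coordinates (x_1,y_1,...,x_m,y_m) is represented as pairs (x,y)
  with x, y in R^m. The field F = (-y_1,x_1,...,-y_m,x_m).\<close>
definition Ffield :: "(real^'m) \<times> (real^'m) \<Rightarrow> (real^'m) \<times> (real^'m)" where
  "Ffield p = (- snd p, fst p)"

definition Sset :: "((real^'m) \<times> (real^'m)) set \<Rightarrow> ((real^'m) \<times> (real^'m) \<Rightarrow> real) \<Rightarrow> ((real^'m) \<times> (real^'m)) set" where
  "Sset \<Omega> w = {p\<in>\<Omega>. grad w p + Ffield p = 0}"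

definition Nfield :: "((real^'m) \<times> (real^'m) \<Rightarrow> real) \<Rightarrow> (real^'m) \<times> (real^'m) \<Rightarrow> (real^'m) \<times> (real^'m)" where
  "Nfield w p = (grad w p + Ffield p) /\<^sub>R norm (grad w p + Ffield p)"

end

theory Submission
  imports Defs
begin

text \<open>
  Put \<open>A = \<nabla>u + F\<close>, \<open>B = \<nabla>v + F\<close>, \<open>w = u - v\<close>, so that \<open>\<nabla>w = A - B\<close> and
  \<open>\<nabla>w \<bullet> (N(u) - N(v)) = (|A| + |B|)/2 |N(u) - N(v)|\<^sup>2\<close>.
  The derivative of \<open>A\<close> is a Hessian plus the skew form of \<open>F\<close>. As \<open>m \<ge> 2\<close>, it has rank at least 2
  everywhere, so \<open>{|A| < \<delta>}\<close> has measure \<open>O(\<delta>\<^sup>2)\<close> on compact sets; the same holds for \<open>B\<close>.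
  Integrate the divergence of \<open>\<phi>(w) \<chi> (N(u) - N(v))\<close>, where \<open>\<phi>(w)\<close> is supported in \<open>{w \<ge> e}\<close> and the
  cutoff \<open>\<chi>\<close> vanishes near the singular sets. The error is \<open>O(1/\<delta>)\<close> on a set of measure
  \<open>O(\<delta>\<^sup>2)\<close>, hence \<open>N(u) = N(v)\<close> wherever \<open>w > 0\<close> and both are defined. There \<open>B = c A\<close>, and comparing the skew
  parts of the derivatives gives \<open>2 (1 - c) (F h \<bullet> k) = dc(h) (A \<bullet> k) - dc(k) (A \<bullet> h)\<close>. The right-hand
  side has rank at most 2 and \<open>F\<close> has rank \<open>2m \<ge> 4\<close>, so \<open>c = 1\<close> and \<open>\<nabla>w = 0\<close>. By density this holds on
  all of \<open>{w > 0}\<close>, and the set where \<open>w\<close> attains a positive maximum would be open and compact.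
\<close>

subsection \<open>Second derivatives\<close>

text \<open>Two applications of the one-dimensional mean value theorem: along \<open>k\<close> to
  the difference of \<open>w\<close> in direction \<open>h\<close>, then along \<open>h\<close> to
  \<open>g \<bullet> k\<close>. The second difference is unchanged when \<open>h\<close> and
  \<open>k\<close> are swapped, which forces the Hessian to be symmetric.\<close>

lemma second_difference_mvt:
  fixes w :: "'a::real_inner \<Rightarrow> real"
  assumes w: "\<And>x. x \<in> ball p e \<Longrightarrow> (w has_derivative (\<lambda>h. g x \<bullet> h)) (at x)"
    and g: "\<And>x. x \<in> ball p e \<Longrightarrow> (g has_derivative H x) (at x)"
    and s: "0 < s" "s * (norm h + norm k) < e"
  shows "\<exists>\<xi>\<in>ball p e. w (p + s *\<^sub>R h + s *\<^sub>R k) - w (p + s *\<^sub>R h) - w (p + s *\<^sub>R k) + w p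
           = s\<^sup>2 * (H \<xi> h \<bullet> k)"
proof -
  have in_ball: "p + \<sigma> *\<^sub>R h + \<tau> *\<^sub>R k \<in> ball p e" if "0 \<le> \<sigma>" "\<sigma> \<le> s" "0 \<le> \<tau>" "\<tau> \<le> s" for \<sigma> \<tau>
  proof -
    have "norm (\<sigma> *\<^sub>R h + \<tau> *\<^sub>R k) \<le> norm (\<sigma> *\<^sub>R h) + norm (\<tau> *\<^sub>R k)"
      by (rule norm_triangle_ineq)
    also have "\<dots> \<le> s * norm h + s * norm k"
      using that by (auto intro!: add_mono mult_right_mono)
    also have "\<dots> < e" using s(2) by (simp add: algebra_simps)
    finally have "norm (\<sigma> *\<^sub>R h + \<tau> *\<^sub>R k) < e" .
    moreover have "dist p (p + (\<sigma> *\<^sub>R h + \<tau> *\<^sub>R k)) = norm (\<sigma> *\<^sub>R h + \<tau> *\<^sub>R k)"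
      unfolding dist_norm by (metis add_diff_cancel_left' norm_minus_commute)
    ultimately show ?thesis by (simp add: add.assoc)
  qed
  \<comment> \<open>\<open>\<phi> s - \<phi> 0\<close> is the second difference. The term
    \<open>0 *\<^sub>R h\<close> is kept so that both summands are instances of one derivative
    formula in \<open>c\<close>.\<close>
  define \<phi> where "\<phi> t = w (p + s *\<^sub>R h + t *\<^sub>R k) - w (p + 0 *\<^sub>R h + t *\<^sub>R k)" for t
  have d\<phi>: "(\<phi> has_derivative
      (\<lambda>r. r * ((g (p + s *\<^sub>R h + t *\<^sub>R k) - g (p + 0 *\<^sub>R h + t *\<^sub>R k)) \<bullet> k))) (at t within {0..s})"
    if t: "0 \<le> t" "t \<le> s" for t
  proof -
    have *: "((\<lambda>t. w (p + c *\<^sub>R h + t *\<^sub>R k)) has_derivative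
        (\<lambda>r. g (p + c *\<^sub>R h + t *\<^sub>R k) \<bullet> (r *\<^sub>R k))) (at t within {0..s})"
      if c: "0 \<le> c" "c \<le> s" for c
      by (rule has_derivative_compose[where g = w and f = "\<lambda>t. p + c *\<^sub>R h + t *\<^sub>R k"
            and f' = "\<lambda>r. r *\<^sub>R k", OF _ w[OF in_ball[OF c t]]])
        (auto intro!: derivative_eq_intros)
    have "0 \<le> s" using s by simp
    from has_derivative_diff[OF *[OF this order_refl] *[OF order_refl this]] show ?thesis
      unfolding \<phi>_def by (simp add: inner_diff_left right_diff_distrib)
  qed
  obtain \<tau> where \<tau>: "\<tau> \<in> {0<..<s}"
    and 1: "\<phi> s - \<phi> 0 = s * ((g (p + s *\<^sub>R h + \<tau> *\<^sub>R k) - g (p + 0 *\<^sub>R h + \<tau> *\<^sub>R k)) \<bullet> k)"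
    using mvt_simple[OF s(1) d\<phi>] by auto
  define \<psi> where "\<psi> r = g (p + r *\<^sub>R h + \<tau> *\<^sub>R k) \<bullet> k" for r
  have d\<psi>: "(\<psi> has_derivative (\<lambda>r. r * (H (p + t *\<^sub>R h + \<tau> *\<^sub>R k) h \<bullet> k))) (at t within {0..s})"
    if "0 \<le> t" "t \<le> s" for t
  proof -
    have "p + t *\<^sub>R h + \<tau> *\<^sub>R k \<in> ball p e" using \<tau> that by (intro in_ball) auto
    note g1 = g[OF this]
    interpret bounded_linear "H (p + t *\<^sub>R h + \<tau> *\<^sub>R k)"
      using g1 by (rule has_derivative_bounded_linear)
    have "((\<lambda>r. g (p + r *\<^sub>R h + \<tau> *\<^sub>R k)) has_derivative
        (\<lambda>r. H (p + t *\<^sub>R h + \<tau> *\<^sub>R k) (r *\<^sub>R h))) (at t within {0..s})"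
      by (rule has_derivative_compose[where g = g and f = "\<lambda>r. p + r *\<^sub>R h + \<tau> *\<^sub>R k"
            and f' = "\<lambda>r. r *\<^sub>R h", OF _ g1]) (auto intro!: derivative_eq_intros)
    from has_derivative_inner_left[OF this, of k] show ?thesis
      unfolding \<psi>_def by (simp add: scaleR)
  qed
  obtain \<sigma> where \<sigma>: "\<sigma> \<in> {0<..<s}"
    and 2: "\<psi> s - \<psi> 0 = s * (H (p + \<sigma> *\<^sub>R h + \<tau> *\<^sub>R k) h \<bullet> k)"
    using mvt_simple[OF s(1) d\<psi>] by auto
  have "\<phi> s - \<phi> 0 = s * (\<psi> s - \<psi> 0)"
    using 1 by (simp add: \<psi>_def inner_diff_left)
  also have "\<dots> = s\<^sup>2 * (H (p + \<sigma> *\<^sub>R h + \<tau> *\<^sub>R k) h \<bullet> k)"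
    unfolding 2 by (simp add: power2_eq_square)
  finally have "\<phi> s - \<phi> 0 = s\<^sup>2 * (H (p + \<sigma> *\<^sub>R h + \<tau> *\<^sub>R k) h \<bullet> k)" .
  then show ?thesis
    using in_ball[of \<sigma> \<tau>] \<sigma> \<tau> by (intro bexI) (auto simp: \<phi>_def)
qed

text \<open>Schwarz's theorem. One second difference equals \<open>s\<^sup>2\<close> times both
  \<open>H \<xi> h \<bullet> k\<close> and \<open>H \<zeta> k \<bullet> h\<close> for points near
  \<open>p\<close>; continuity of \<open>H\<close> then rules out any gap at
  \<open>p\<close>.\<close>

lemma second_derivative_symmetric:
  fixes w :: "'a::real_inner \<Rightarrow> real"
  assumes \<Omega>: "open \<Omega>" "p \<in> \<Omega>"
    and w: "\<And>x. x \<in> \<Omega> \<Longrightarrow> (w has_derivative (\<lambda>h. g x \<bullet> h)) (at x)"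
    and g: "\<And>x. x \<in> \<Omega> \<Longrightarrow> (g has_derivative H x) (at x)"
    and H: "\<And>h. continuous_on \<Omega> (\<lambda>x. H x h)"
  shows "H p h \<bullet> k = H p k \<bullet> h"
proof (rule ccontr)
  \<comment> \<open>Half the gap, so that values within \<open>d\<close> of the two sides cannot
    coincide.\<close>
  define d where "d = \<bar>H p h \<bullet> k - H p k \<bullet> h\<bar> / 2"
  assume "H p h \<bullet> k \<noteq> H p k \<bullet> h"
  then have "d > 0" by (auto simp: d_def)
  have near: "\<forall>\<^sub>F x in at p. dist (H x h \<bullet> k) (H p h \<bullet> k) < d" for h k
  proof -
    have "continuous_on \<Omega> (\<lambda>x. H x h \<bullet> k)" by (intro continuous_intros H)
    then have "isCont (\<lambda>x. H x h \<bullet> k) p" using \<Omega> continuous_on_eq_continuous_at by blast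
    then show ?thesis using \<open>d > 0\<close> tendstoD unfolding isCont_def by blast
  qed
  have "\<forall>\<^sub>F x in at p. x \<in> \<Omega>" using \<Omega> by (simp add: eventually_at_in_open')
  with near[of h k] near[of k h]
  have "\<forall>\<^sub>F x in at p. x \<in> \<Omega> \<and> dist (H x h \<bullet> k) (H p h \<bullet> k) < d \<and> dist (H x k \<bullet> h) (H p k \<bullet> h) < d"
    by eventually_elim auto
  then obtain e where "e > 0"
    and e': "\<And>x. x \<noteq> p \<Longrightarrow> dist x p < e \<Longrightarrow>
       x \<in> \<Omega> \<and> dist (H x h \<bullet> k) (H p h \<bullet> k) < d \<and> dist (H x k \<bullet> h) (H p k \<bullet> h) < d"
    unfolding eventually_at by auto
  have e: "x \<in> \<Omega> \<and> dist (H x h \<bullet> k) (H p h \<bullet> k) < d \<and> dist (H x k \<bullet> h) (H p k \<bullet> h) < d"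
    if "x \<in> ball p e" for x
    using e'[of x] that \<Omega> \<open>d > 0\<close> by (cases "x = p") (auto simp: dist_commute)
  define s where "s = e / (norm h + norm k + 1)"
  have pos: "norm h + norm k + 1 > 0" by (smt (verit) norm_ge_zero)
  have s: "0 < s" "s * (norm h + norm k) < e" "s * (norm k + norm h) < e"
    using \<open>e > 0\<close> pos by (auto simp: s_def field_simps)
  obtain \<xi> where \<xi>: "\<xi> \<in> ball p e"
    "w (p + s *\<^sub>R h + s *\<^sub>R k) - w (p + s *\<^sub>R h) - w (p + s *\<^sub>R k) + w p = s\<^sup>2 * (H \<xi> h \<bullet> k)"
    using second_difference_mvt[OF w g s(1,2), of p] e by blast
  obtain \<zeta> where \<zeta>: "\<zeta> \<in> ball p e"
    "w (p + s *\<^sub>R k + s *\<^sub>R h) - w (p + s *\<^sub>R k) - w (p + s *\<^sub>R h) + w p = s\<^sup>2 * (H \<zeta> k \<bullet> h)"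
    using second_difference_mvt[OF w g s(1,3), of p] e by blast
  have "w (p + s *\<^sub>R h + s *\<^sub>R k) = w (p + s *\<^sub>R k + s *\<^sub>R h)" by (simp add: algebra_simps)
  then have "s\<^sup>2 * (H \<xi> h \<bullet> k) = s\<^sup>2 * (H \<zeta> k \<bullet> h)"
    unfolding \<xi>(2)[symmetric] \<zeta>(2)[symmetric] by simp
  then have "H \<xi> h \<bullet> k = H \<zeta> k \<bullet> h" using s by simp
  moreover have "dist (H \<xi> h \<bullet> k) (H p h \<bullet> k) < d" "dist (H \<zeta> k \<bullet> h) (H p k \<bullet> h) < d"
    using e \<xi> \<zeta> by auto
  ultimately show False
    using dist_triangle_half_r[of "H \<xi> h \<bullet> k" "H p h \<bullet> k" "2 * d" "H p k \<bullet> h"]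
    by (simp add: d_def dist_real_def)
qed

lemma grad_has_derivative:
  assumes "w differentiable (at p)"
  shows "(w has_derivative (\<lambda>h. grad w p \<bullet> h)) (at p)"
proof -
  let ?D = "frechet_derivative w (at p)"
  have "linear ?D" using assms by (rule linear_frechet_derivative)
  then interpret linear ?D .
  have "?D h = grad w p \<bullet> h" for h
  proof -
    have "?D h = ?D (\<Sum>b\<in>Basis. (h \<bullet> b) *\<^sub>R b)" by (simp add: euclidean_representation)
    also have "\<dots> = (\<Sum>b\<in>Basis. (h \<bullet> b) * ?D b)" by (simp add: sum scale)
    also have "\<dots> = grad w p \<bullet> h"
      by (simp add: grad_def inner_sum_right inner_commute[of _ h] mult.commute)
    finally show ?thesis .
  qed
  then have "?D = (\<lambda>h. grad w p \<bullet> h)" by auto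
  then show ?thesis using assms frechet_derivative_works[of w "at p"] by simp
qed

lemma C2_on_hessian:
  assumes "open \<Omega>" "C2_on \<Omega> w"
  obtains H where "\<And>p. p \<in> \<Omega> \<Longrightarrow> (w has_derivative (\<lambda>h. grad w p \<bullet> h)) (at p)"
    "\<And>p. p \<in> \<Omega> \<Longrightarrow> (grad w has_derivative H p) (at p)"
    "\<And>h. continuous_on \<Omega> (\<lambda>p. H p h)"
    "\<And>p h k. p \<in> \<Omega> \<Longrightarrow> H p h \<bullet> k = H p k \<bullet> h"
proof
  \<comment> \<open>\<open>C2_on\<close> speaks of the components of the gradient, so the Hessian is
    assembled from their gradients.\<close>
  define H where "H p h = (\<Sum>b\<in>Basis. (grad (\<lambda>q. grad w q \<bullet> b) p \<bullet> h) *\<^sub>R b)" for p h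
  show 1: "(w has_derivative (\<lambda>h. grad w p \<bullet> h)) (at p)" if "p \<in> \<Omega>" for p
    using assms that by (intro grad_has_derivative) (auto simp: C2_on_def C1_on_def)
  show 2: "(grad w has_derivative H p) (at p)" if "p \<in> \<Omega>" for p
  proof (subst has_derivative_componentwise_within, intro ballI)
    fix b :: 'a assume b: "b \<in> Basis"
    have "(\<lambda>h. H p h \<bullet> b) = (\<lambda>h. grad (\<lambda>q. grad w q \<bullet> b) p \<bullet> h)"
      using b by (simp add: H_def)
    then show "((\<lambda>x. grad w x \<bullet> b) has_derivative (\<lambda>h. H p h \<bullet> b)) (at p)"
      using assms that b by (auto intro!: grad_has_derivative simp: C2_on_def C1_on_def)
  qed
  show 3: "continuous_on \<Omega> (\<lambda>p. H p h)" for h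
    unfolding H_def using assms by (intro continuous_intros) (auto simp: C2_on_def C1_on_def)
  show "H p h \<bullet> k = H p k \<bullet> h" if "p \<in> \<Omega>" for p h k
    using second_derivative_symmetric[OF assms(1) that 1 2 3] by blast
qed

subsection \<open>The skew form of F\<close>

lemma Ffield_linear: "linear Ffield"
  by (rule linearI) (auto simp: Ffield_def)

lemma Ffield_skew: "Ffield h \<bullet> k = - (Ffield k \<bullet> h)"
  by (cases h; cases k) (simp add: Ffield_def inner_Pair inner_commute)

text \<open>Antisymmetrising removes the symmetric Hessian and leaves twice the skew map
  \<open>Ffield\<close>. The skew part is thus the same for every \<open>w\<close>; both the rank
  bound and the step from parallel to equal fields rest on this.\<close>

lemma C2_on_grad_plus_Ffield:
  fixes w :: "(real^'m) \<times> (real^'m) \<Rightarrow> real"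
  assumes "open \<Omega>" "C2_on \<Omega> w"
  shows "\<exists>D. (\<forall>p\<in>\<Omega>. ((\<lambda>p. grad w p + Ffield p) has_derivative D p) (at p)) \<and>
    (\<forall>h. continuous_on \<Omega> (\<lambda>p. D p h)) \<and>
    (\<forall>p\<in>\<Omega>. \<forall>h k. D p h \<bullet> k - D p k \<bullet> h = 2 * (Ffield h \<bullet> k))"
proof -
  obtain H where H: "\<And>p. p \<in> \<Omega> \<Longrightarrow> (grad w has_derivative H p) (at p)"
    "\<And>h. continuous_on \<Omega> (\<lambda>p. H p h)"
    "\<And>p h k. p \<in> \<Omega> \<Longrightarrow> H p h \<bullet> k = H p k \<bullet> h"
    using C2_on_hessian[OF assms] by metis
  show ?thesis
  proof (intro exI[of _ "\<lambda>p h. H p h + Ffield h"] conjI ballI allI)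
    show "((\<lambda>p. grad w p + Ffield p) has_derivative (\<lambda>h. H p h + Ffield h)) (at p)"
      if "p \<in> \<Omega>" for p
      by (intro has_derivative_add H that linear_imp_has_derivative Ffield_linear)
    show "continuous_on \<Omega> (\<lambda>p. H p h + Ffield h)" for h
      by (intro continuous_intros H)
    show "(H p h + Ffield h) \<bullet> k - (H p k + Ffield k) \<bullet> h = 2 * (Ffield h \<bullet> k)"
      if "p \<in> \<Omega>" for p h k
      using H(3)[OF that, of h k] Ffield_skew[of h k] by (simp add: inner_add_left)
  qed
qed

text \<open>The form \<^term>\<open>\<lambda>h k. Ffield h \<bullet> k\<close> is nondegenerate on a space of dimension at least 4,
  whereas the right-hand side below has rank at most 2.\<close>
lemma Ffield_not_decomposable:
  fixes g :: "(real^'m) \<times> (real^'m)"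
  assumes card: "CARD('m) \<ge> 2"
    and l: "linear (l :: _ \<Rightarrow> real)"
    and eq: "\<And>h k. \<mu> * (Ffield h \<bullet> k) = l h * (g \<bullet> k) - l k * (g \<bullet> h)"
  shows "\<mu> = 0"
proof -
  define a where "a = adjoint l 1"
  have la: "l h = a \<bullet> h" for h
    using adjoint_works[OF l, of h 1] by (simp add: a_def inner_commute)
  have "dim (span {a, g}) < DIM((real^'m) \<times> (real^'m))"
  proof -
    have "dim (span {a, g}) \<le> card {a, g}" by (simp add: dim_le_card')
    also have "\<dots> \<le> 2" by (simp add: card_insert_le_m1)
    finally show ?thesis using card by simp
  qed
  then obtain h where h: "h \<noteq> 0" "\<And>x. x \<in> span {a, g} \<Longrightarrow> orthogonal h x"
    using orthogonal_to_subspace_exists[of "{a, g}"] by auto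
  have "a \<bullet> h = 0" "g \<bullet> h = 0"
    using h(2)[of a] h(2)[of g] by (auto simp: span_base orthogonal_def inner_commute)
  \<comment> \<open>Choose \<open>k = Ffield h\<close>: the right-hand side of \<open>eq\<close>
    vanishes because \<open>h\<close> is orthogonal to \<open>a\<close> and
    \<open>g\<close>.\<close>
  then have "\<mu> * (Ffield h \<bullet> Ffield h) = 0"
    unfolding eq la by simp
  moreover have "Ffield h \<noteq> 0" using h(1) by (cases h) (auto simp: Ffield_def zero_prod_def)
  ultimately show ?thesis by simp
qed

text \<open>If the rank were at most 1, then \<open>D b = l b *\<^sub>R D a\<close> for a linear
  form \<open>l\<close>, and the skew part would be decomposable, which
  \<open>Ffield_not_decomposable\<close> forbids. Rank at least 2 is stated as injectivity in the
  parameters \<open>s\<close>, \<open>t\<close>, the form that the translation estimate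
  uses.\<close>

lemma skew_part_Ffield_rank_two:
  fixes D :: "(real^'m) \<times> (real^'m) \<Rightarrow> (real^'m) \<times> (real^'m)"
  assumes card: "CARD('m) \<ge> 2" and lin: "linear D"
    and skew: "\<And>h k. D h \<bullet> k - D k \<bullet> h = 2 * (Ffield h \<bullet> k)"
  shows "\<exists>a b. \<forall>s t. D (s *\<^sub>R a + t *\<^sub>R b) = 0 \<longrightarrow> s = 0 \<and> t = 0"
proof (rule ccontr)
  assume "\<not> ?thesis"
  then have dep: "\<exists>s t. D (s *\<^sub>R a + t *\<^sub>R b) = 0 \<and> (s \<noteq> 0 \<or> t \<noteq> 0)" for a b by blast
  have "\<exists>a. D a \<noteq> 0"
  proof (rule ccontr)
    assume "\<not> ?thesis"
    then have "2 * (Ffield h \<bullet> k) = 0 * (0 \<bullet> k) - 0 * (0 \<bullet> h)"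
      for h k :: "(real^'m) \<times> (real^'m)"
      using skew[of h k] \<open>\<not> (\<exists>a. D a \<noteq> 0)\<close> by (metis inner_zero_left diff_self mult_zero_left)
    from Ffield_not_decomposable[OF card _ this] show False by (simp add: linear_zero)
  qed
  then obtain a where a: "D a \<noteq> 0" by blast
  \<comment> \<open>The normalised inner product with \<open>D a\<close> recovers the coefficient of
    \<open>D b\<close> and is visibly linear in \<open>b\<close>.\<close>
  define l where "l b = (D b \<bullet> D a) / (D a \<bullet> D a)" for b
  have "D b = l b *\<^sub>R D a" for b
  proof -
    obtain s t where st: "D (s *\<^sub>R a + t *\<^sub>R b) = 0" "s \<noteq> 0 \<or> t \<noteq> 0" using dep by blast
    then have st': "s *\<^sub>R D a + t *\<^sub>R D b = 0" using lin by (simp add: linear_add linear_scale)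
    with st(2) a have "t \<noteq> 0" by auto
    then have "D b = (1 / t) *\<^sub>R (t *\<^sub>R D b)" by simp
    also have "t *\<^sub>R D b = - s *\<^sub>R D a" using st' by (simp add: add_eq_0_iff)
    finally have "D b = (- s / t) *\<^sub>R D a" by simp
    then show ?thesis using a by (simp add: l_def)
  qed
  then have "2 * (Ffield h \<bullet> k) = l h * (D a \<bullet> k) - l k * (D a \<bullet> h)" for h k
    using skew[of h k] by (metis inner_scaleR_left)
  moreover have "linear l"
    unfolding l_def using lin
    by (intro linearI) (simp_all add: linear_add linear_scale inner_add_left add_divide_distrib)
  ultimately show False using Ffield_not_decomposable[OF card, of l 2 "D a"] by simp
qed

subsection \<open>Measure of neighbourhoods of zero sets\<close>

text \<open>The bound is a finite sum that depends continuously on the vectors \<open>f b\<close>.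
  It turns continuity of \<open>D x h\<close> in \<open>x\<close>, for each fixed \<open>h\<close>,
  into uniform control of the linear maps \<open>D x\<close>.\<close>

lemma linear_norm_le_sum_Basis:
  fixes f :: "'a::euclidean_space \<Rightarrow> 'b::real_normed_vector"
  assumes "linear f"
  shows "norm (f h) \<le> norm h * (\<Sum>b\<in>Basis. norm (f b))"
proof -
  have "f h = f (\<Sum>b\<in>Basis. (h \<bullet> b) *\<^sub>R b)" by (simp add: euclidean_representation)
  also have "\<dots> = (\<Sum>b\<in>Basis. (h \<bullet> b) *\<^sub>R f b)"
    using assms by (simp add: linear_sum linear_scale)
  also have "norm \<dots> \<le> (\<Sum>b\<in>Basis. norm h * norm (f b))"
    by (rule sum_norm_le) (auto intro!: mult_right_mono Basis_le_norm)
  finally show ?thesis by (simp add: sum_distrib_left)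
qed

text \<open>By \<open>sep\<close>, the translates of \<open>M\<close> by the points of a grid of mesh \<open>K \<delta>\<close> in the plane of \<open>a\<close> and
  \<open>b\<close> are disjoint. About \<open>1 / \<delta>\<^sup>2\<close> of them fit into a fixed ball.\<close>

lemma measure_le_of_disjoint_translates:
  fixes a b :: "'a::euclidean_space"
  assumes M: "M \<in> lmeasurable" "M \<subseteq> cball p r"
    and \<delta>: "0 < \<delta>" "\<delta> \<le> 1" and K: "0 \<le> K"
    and sep: "\<And>x y s t. x \<in> M \<Longrightarrow> y \<in> M \<Longrightarrow> y - x = s *\<^sub>R a + t *\<^sub>R b \<Longrightarrow>
       \<bar>s\<bar> < K * \<delta> \<and> \<bar>t\<bar> < K * \<delta>"
  shows "measure lebesgue M \<le> measure lebesgue (cball p (r + K * (norm a + norm b))) * \<delta>\<^sup>2"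
proof -
  \<comment> \<open>The shifts \<open>K * \<delta> * real i\<close> with \<open>i < k\<close> are at
    most \<open>K\<close>, so the translates stay in a fixed ball, while
    \<open>k * \<delta> \<ge> 1\<close> makes the number of grid points at least
    \<open>1 / \<delta>\<^sup>2\<close>.\<close>
  define k where "k = nat \<lceil>1/\<delta>\<rceil>"
  define T where "T = (\<lambda>(i::nat, j::nat). (K * \<delta> * real i) *\<^sub>R a + (K * \<delta> * real j) *\<^sub>R b)"
  define I where "I = {..<k} \<times> {..<k}"
  have k: "1/\<delta> \<le> real k" using \<delta> by (simp add: k_def)
  have k': "real i * \<delta> \<le> 1" if "i < k" for i
  proof -
    have "int i < \<lceil>1/\<delta>\<rceil>" using that by (simp add: k_def)
    then have "real i < 1/\<delta>" by (simp add: less_ceiling_iff)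
    then show ?thesis using \<delta> by (simp add: field_simps)
  qed
  have KT: "K * \<delta> * real i \<le> K" "0 \<le> K * \<delta> * real i" if "i < k" for i
    using mult_left_mono[OF k'[OF that] K] K \<delta> by (auto simp: algebra_simps)
  have sub: "(+) (T z) ` M \<subseteq> cball p (r + K * (norm a + norm b))" if zI: "z \<in> I" for z
  proof (clarsimp simp: dist_norm)
    fix x assume "x \<in> M"
    then have "norm (p - x) \<le> r" using M(2) by (auto simp: dist_norm)
    moreover obtain i j where z: "z = (i, j)" "i < k" "j < k" using zI by (auto simp: I_def)
    have "norm (T z) \<le> norm ((K * \<delta> * real i) *\<^sub>R a) + norm ((K * \<delta> * real j) *\<^sub>R b)"
      unfolding T_def z prod.case by (rule norm_triangle_ineq)
    moreover have "norm ((K * \<delta> * real i) *\<^sub>R a) \<le> K * norm a"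
      using KT[OF z(2)] by (auto intro!: mult_right_mono)
    moreover have "norm ((K * \<delta> * real j) *\<^sub>R b) \<le> K * norm b"
      using KT[OF z(3)] by (auto intro!: mult_right_mono)
    moreover have "norm (p - (T z + x)) \<le> norm (p - x) + norm (T z)"
      using norm_triangle_ineq4[of "p - x" "T z"] by (simp add: algebra_simps)
    ultimately show "norm (p - (T z + x)) \<le> r + K * (norm a + norm b)"
      by (simp add: algebra_simps)
  qed
  have disj: "disjoint_family_on (\<lambda>z. (+) (T z) ` M) I"
  proof (clarsimp simp: disjoint_family_on_def I_def, rule ccontr)
    fix i j i' j' :: nat
    assume ne: "i = i' \<longrightarrow> j \<noteq> j'" and "(+) (T (i, j)) ` M \<inter> (+) (T (i', j')) ` M \<noteq> {}"
    then obtain x y where xy: "x \<in> M" "y \<in> M" "T (i, j) + x = T (i', j') + y" by auto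
    then have "y - x = T (i, j) - T (i', j')" by (simp add: algebra_simps)
    also have "\<dots> = (K * \<delta> * (real i - real i')) *\<^sub>R a + (K * \<delta> * (real j - real j')) *\<^sub>R b"
      by (simp add: T_def algebra_simps)
    finally have "\<bar>K * \<delta> * (real i - real i')\<bar> < K * \<delta>" "\<bar>K * \<delta> * (real j - real j')\<bar> < K * \<delta>"
      using sep xy by blast+
    \<comment> \<open>The bound in \<open>sep\<close> is strict, so a common point of two translates
      already excludes \<open>K = 0\<close>.\<close>
    moreover from this have "K > 0" using K \<delta> by (cases "K = 0") auto
    ultimately have "\<bar>real i - real i'\<bar> < 1" "\<bar>real j - real j'\<bar> < 1"
      using \<delta> by (simp_all add: abs_mult)
    then have "i = i'" "j = j'" by linarith+
    with ne show False by simp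
  qed
  have "real (card I) * measure lebesgue M = (\<Sum>z\<in>I. measure lebesgue ((+) (T z) ` M))"
    by (simp add: measure_translation)
  also have "\<dots> = measure lebesgue (\<Union>z\<in>I. (+) (T z) ` M)"
    using disj measurable_translation[OF M(1)]
    by (intro measure_finite_Union[symmetric])
      (auto simp: I_def fmeasurableD simp del: emeasure_completion dest: fmeasurableD2)
  also have "\<dots> \<le> measure lebesgue (cball p (r + K * (norm a + norm b)))"
    using sub measurable_translation[OF M(1)]
    by (intro measure_mono_fmeasurable) (auto simp: I_def intro!: sets.finite_UN fmeasurableD)
  finally have 1: "real (card I) * measure lebesgue M
      \<le> measure lebesgue (cball p (r + K * (norm a + norm b)))" .
  have "1 \<le> (real k * \<delta>)\<^sup>2"
    using k \<delta> by (intro one_le_power) (simp add: field_simps)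
  then have "measure lebesgue M \<le> (real k * \<delta>)\<^sup>2 * measure lebesgue M"
    by (simp add: mult_le_cancel_right1)
  also have "\<dots> = (real (card I) * measure lebesgue M) * \<delta>\<^sup>2"
    by (simp add: I_def power2_eq_square)
  also have "\<dots> \<le> measure lebesgue (cball p (r + K * (norm a + norm b))) * \<delta>\<^sup>2"
    using 1 by (rule mult_right_mono) simp
  finally show ?thesis .
qed

lemma continuous_derivative_onorm:
  fixes D :: "'a::euclidean_space \<Rightarrow> 'a \<Rightarrow> 'b::real_normed_vector"
  assumes "open \<Omega>" "p \<in> \<Omega>" and lin: "\<And>x. x \<in> \<Omega> \<Longrightarrow> bounded_linear (D x)"
    and D: "\<And>h. continuous_on \<Omega> (\<lambda>x. D x h)" and "0 < e"
  obtains r where "0 < r" "ball p r \<subseteq> \<Omega>" "\<And>x. x \<in> ball p r \<Longrightarrow> onorm (D x - D p) \<le> e"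
proof -
  have "isCont (\<lambda>x. \<Sum>b\<in>Basis. norm (D x b - D p b)) p"
    using assms(1,2) D by (intro continuous_intros) (auto simp: continuous_on_eq_continuous_at)
  then have "\<forall>\<^sub>F x in at p. dist (\<Sum>b\<in>Basis. norm (D x b - D p b)) (\<Sum>b\<in>Basis. norm (D p b - D p b)) < e"
    using \<open>0 < e\<close> tendstoD unfolding isCont_def by blast
  moreover have "\<forall>\<^sub>F x in at p. x \<in> \<Omega>" using assms(1,2) by (simp add: eventually_at_in_open')
  ultimately have "\<forall>\<^sub>F x in at p. x \<in> \<Omega> \<and> (\<Sum>b\<in>Basis. norm (D x b - D p b)) < e"
    by eventually_elim (auto simp: dist_real_def)
  then obtain r where r: "0 < r" "\<And>x. x \<noteq> p \<Longrightarrow> dist x p < r \<Longrightarrow> x \<in> \<Omega> \<and> (\<Sum>b\<in>Basis. norm (D x b - D p b)) < e"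
    unfolding eventually_at by auto
  have r': "x \<in> \<Omega> \<and> (\<Sum>b\<in>Basis. norm (D x b - D p b)) < e" if "x \<in> ball p r" for x
    using r(2)[of x] that assms by (cases "x = p") (auto simp: dist_commute)
  show ?thesis
  proof
    show "onorm (D x - D p) \<le> e" if "x \<in> ball p r" for x
    proof (rule onorm_bound)
      fix h
      have "bounded_linear (\<lambda>h. D x h - D p h)"
        using that r' assms by (intro bounded_linear_sub lin) auto
      then have "norm (D x h - D p h) \<le> norm h * (\<Sum>b\<in>Basis. norm (D x b - D p b))"
        by (intro linear_norm_le_sum_Basis) (rule bounded_linear.linear)
      also have "\<dots> \<le> norm h * e" using r'[OF that] by (intro mult_left_mono) auto
      finally show "norm ((D x - D p) h) \<le> e * norm h" by (simp add: mult.commute)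
    qed (use \<open>0 < e\<close> in simp)
  qed (use r r' in auto)
qed

lemma derivative_bound_compact:
  fixes D :: "'a::t2_space \<Rightarrow> 'b::euclidean_space \<Rightarrow> 'c::real_normed_vector"
  assumes K: "compact K" and lin: "\<And>x. x \<in> K \<Longrightarrow> linear (D x)"
    and D: "\<And>h. continuous_on K (\<lambda>x. D x h)"
  obtains M where "0 \<le> M" "\<And>x h. x \<in> K \<Longrightarrow> norm (D x h) \<le> M * norm h"
proof -
  have "continuous_on K (\<lambda>x. \<Sum>b\<in>Basis. norm (D x b))"
    by (intro continuous_on_sum continuous_on_norm D)
  then have "bounded ((\<lambda>x. \<Sum>b\<in>Basis. norm (D x b)) ` K)"
    using K by (intro compact_imp_bounded compact_continuous_image)
  then obtain M where M: "0 < M" "\<And>x. x \<in> K \<Longrightarrow> \<bar>\<Sum>b\<in>Basis. norm (D x b)\<bar> \<le> M"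
    unfolding bounded_pos by auto
  show ?thesis
  proof
    fix x h assume x: "x \<in> K"
    have "norm (D x h) \<le> norm h * (\<Sum>b\<in>Basis. norm (D x b))"
      by (rule linear_norm_le_sum_Basis[OF lin[OF x]])
    also have "\<dots> \<le> norm h * M" using M(2)[OF x] by (intro mult_left_mono) auto
    finally show "norm (D x h) \<le> M * norm h" by (simp add: mult.commute)
  qed (use M in auto)
qed

text \<open>Near \<open>p\<close> the derivative stays close to \<open>D p\<close>, which is
  injective on the plane of \<open>a\<close> and \<open>b\<close>. So \<open>A\<close> separates
  points whose difference lies in this plane, and two such points of \<open>M\<close> have
  parameters of order \<open>\<delta>\<close>. This is the separation that the translation estimate
  asks for.\<close>

lemma rank_two_local_measure:
  fixes A :: "'a::euclidean_space \<Rightarrow> 'b::euclidean_space"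
  assumes \<Omega>: "open \<Omega>" "p \<in> \<Omega>"
    and A: "\<And>x. x \<in> \<Omega> \<Longrightarrow> (A has_derivative D x) (at x)"
    and D: "\<And>h. continuous_on \<Omega> (\<lambda>x. D x h)"
    and rank: "\<And>s t. D p (s *\<^sub>R a + t *\<^sub>R b) = 0 \<Longrightarrow> s = 0 \<and> t = 0"
  shows "\<exists>r C. 0 < r \<and> 0 \<le> C \<and> (\<forall>\<delta> M. 0 < \<delta> \<and> \<delta> \<le> 1 \<and> M \<in> lmeasurable \<and> M \<subseteq> \<Omega> \<inter> ball p r \<and>
       (\<forall>x\<in>M. norm (A x) < \<delta>) \<longrightarrow> measure lebesgue M \<le> C * \<delta>\<^sup>2)"
proof -
  have lin: "bounded_linear (D x)" if "x \<in> \<Omega>" for x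
    using A[OF that] by (rule has_derivative_bounded_linear)
  interpret Dp: bounded_linear "D p" using \<Omega>(2) by (rule lin)
  define L where "L = (\<lambda>(s::real, t::real). D p (s *\<^sub>R a + t *\<^sub>R b))"
  have "linear L"
    by (rule linearI) (auto simp: L_def Dp.add Dp.scaleR algebra_simps)
  moreover from this have "inj L"
    using rank by (auto simp: linear_injective_0 L_def zero_prod_def)
  ultimately obtain c where c: "c > 0" "\<And>z. c * norm z \<le> norm (L z)"
    using linear_inj_bounded_below_pos by blast
  \<comment> \<open>\<open>n\<close> bounds the length of
    \<open>s *\<^sub>R a + t *\<^sub>R b\<close> relative to \<open>norm (s, t)\<close>. With
    derivative error \<open>c / (2 * n)\<close>, linearisation costs only half of the lower bound
    \<open>c * norm (s, t)\<close>.\<close>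
  define n where "n = norm a + norm b + 1"
  have n: "n > 0" by (simp add: n_def add_nonneg_pos)
  obtain r where r: "0 < r" "ball p r \<subseteq> \<Omega>" "\<And>x. x \<in> ball p r \<Longrightarrow> onorm (D x - D p) \<le> c / (2 * n)"
    using continuous_derivative_onorm[OF \<Omega> lin D, of "c / (2 * n)"] c n by auto
  have below: "c / 2 * norm (s, t) \<le> norm (A y - A x)"
    if "x \<in> ball p r" "y \<in> ball p r" "y - x = s *\<^sub>R a + t *\<^sub>R b" for x y s t
  proof -
    have 1: "norm (A y - A x - D p (y - x)) \<le> norm (y - x) * (c / (2 * n))"
    proof (rule differentiable_bound_linearization[where S = "ball p r" and f' = D])
      show "x + u *\<^sub>R (y - x) \<in> ball p r" if "u \<in> {0..1}" for u
        using that \<open>x \<in> ball p r\<close> \<open>y \<in> ball p r\<close> convex_ball[of p r]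
        by (auto simp: convex_alt algebra_simps simp del: mem_ball)
      show "(A has_derivative D x) (at x within ball p r)" if "x \<in> ball p r" for x
        using A r that by (blast intro: has_derivative_at_withinI)
    qed (use r in auto)
    have "norm (y - x) \<le> n * norm (s, t)"
    proof -
      have "norm (y - x) \<le> \<bar>s\<bar> * norm a + \<bar>t\<bar> * norm b"
        unfolding that using norm_triangle_ineq[of "s *\<^sub>R a" "t *\<^sub>R b"] by simp
      also have "\<dots> \<le> norm (s, t) * norm a + norm (s, t) * norm b"
        using norm_fst_le[of s t] norm_snd_le[of t s]
        by (intro add_mono mult_right_mono) auto
      also have "\<dots> \<le> n * norm (s, t)" by (simp add: n_def algebra_simps)
      finally show ?thesis .
    qed
    then have "norm (y - x) * (c / (2 * n)) \<le> n * norm (s, t) * (c / (2 * n))"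
      using c n by (intro mult_right_mono) auto
    also have "\<dots> = c / 2 * norm (s, t)" using n by simp
    finally have "norm (A y - A x - D p (y - x)) \<le> c / 2 * norm (s, t)"
      using 1 by linarith
    moreover have "c * norm (s, t) \<le> norm (D p (y - x))"
      using c(2)[of "(s, t)"] by (simp add: L_def that)
    moreover have "norm (D p (y - x)) \<le> norm (A y - A x) + norm (A y - A x - D p (y - x))"
      using norm_triangle_ineq4[of "A y - A x" "A y - A x - D p (y - x)"] by simp
    ultimately show ?thesis by simp
  qed
  show ?thesis
  \<comment> \<open>The factor \<open>4 / c\<close> comes from
    \<open>c / 2 * norm (s, t) < 2 * \<delta>\<close>: two values of norm below
    \<open>\<delta>\<close> are less than \<open>2 * \<delta>\<close> apart.\<close>
  proof (rule exI[of _ r], rule exI[of _ "measure lebesgue (cball p (r + (4 / c) * (norm a + norm b)))"],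
      intro conjI allI impI; (elim conjE)?)
    fix \<delta> :: real and M
    assume \<delta>: "0 < \<delta>" "\<delta> \<le> 1" and M: "M \<in> lmeasurable" "M \<subseteq> \<Omega> \<inter> ball p r"
      and "\<forall>x\<in>M. norm (A x) < \<delta>"
    then have A\<delta>: "\<And>x. x \<in> M \<Longrightarrow> norm (A x) < \<delta>" by blast
    show "measure lebesgue M \<le> measure lebesgue (cball p (r + (4 / c) * (norm a + norm b))) * \<delta>\<^sup>2"
    proof (rule measure_le_of_disjoint_translates[OF M(1) _ \<delta>])
      show "M \<subseteq> cball p r" using M by auto
      show "\<bar>s\<bar> < 4 / c * \<delta> \<and> \<bar>t\<bar> < 4 / c * \<delta>"
        if "x \<in> M" "y \<in> M" "y - x = s *\<^sub>R a + t *\<^sub>R b" for x y s t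
      proof -
        have "c / 2 * norm (s, t) \<le> norm (A y - A x)" using M that by (intro below) auto
        also have "\<dots> < 2 * \<delta>"
          using norm_triangle_ineq4[of "A y" "A x"] A\<delta>[OF that(1)] A\<delta>[OF that(2)] by linarith
        finally have "norm (s, t) < 4 / c * \<delta>" using c by (simp add: field_simps)
        then show ?thesis using norm_fst_le[of s t] norm_snd_le[of t s] by auto
      qed
    qed (use c in auto)
  qed (use r in auto)
qed

lemma compact_superlevel:
  fixes f :: "'a::t2_space \<Rightarrow> real"
  assumes "compact K" "continuous_on K f"
  shows "compact {x\<in>K. c \<le> f x}"
proof -
  have "closed (K \<inter> f -` {c..})"
    using assms by (intro continuous_closed_preimage compact_imp_closed[OF assms(1)]) auto
  then have "compact (K \<inter> (K \<inter> f -` {c..}))" using assms by blast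
  also have "K \<inter> (K \<inter> f -` {c..}) = {x\<in>K. c \<le> f x}" by auto
  finally show ?thesis .
qed

text \<open>Finitely many of the local balls cover \<open>K\<close>, and their constants add up. The
  sublevel sets are measurable as differences of two compact sets.\<close>

lemma rank_two_sublevel_measure:
  fixes A :: "'a::euclidean_space \<Rightarrow> 'b::euclidean_space"
  assumes \<Omega>: "open \<Omega>"
    and A: "\<And>x. x \<in> \<Omega> \<Longrightarrow> (A has_derivative D x) (at x)"
    and D: "\<And>h. continuous_on \<Omega> (\<lambda>x. D x h)"
    and rank: "\<And>x. x \<in> \<Omega> \<Longrightarrow> \<exists>a b. \<forall>s t. D x (s *\<^sub>R a + t *\<^sub>R b) = 0 \<longrightarrow> s = 0 \<and> t = 0"
    and K: "compact K" "K \<subseteq> \<Omega>"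
  obtains C where "0 \<le> C"
    "\<And>\<delta>. 0 < \<delta> \<Longrightarrow> \<delta> \<le> 1 \<Longrightarrow> {x\<in>K. norm (A x) < \<delta>} \<in> lmeasurable"
    "\<And>\<delta>. 0 < \<delta> \<Longrightarrow> \<delta> \<le> 1 \<Longrightarrow> measure lebesgue {x\<in>K. norm (A x) < \<delta>} \<le> C * \<delta>\<^sup>2"
proof -
  have contA: "continuous_on K A"
    using A K(2) by (meson has_derivative_continuous continuous_at_imp_continuous_on subset_iff)
  have meas: "{x\<in>K. norm (A x) < \<delta>} \<in> lmeasurable" for \<delta>
  proof -
    have "compact {x\<in>K. \<delta> \<le> norm (A x)}"
      using K contA by (intro compact_superlevel continuous_intros)
    then have "K - {x\<in>K. \<delta> \<le> norm (A x)} \<in> lmeasurable"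
      using K by (intro fmeasurable.Diff lmeasurable_compact)
    also have "K - {x\<in>K. \<delta> \<le> norm (A x)} = {x\<in>K. norm (A x) < \<delta>}" by auto
    finally show ?thesis .
  qed
  define Q where "Q p r C \<longleftrightarrow> (\<forall>\<delta> M. 0 < \<delta> \<and> \<delta> \<le> 1 \<and> M \<in> lmeasurable \<and> M \<subseteq> \<Omega> \<inter> ball p r \<and>
       (\<forall>x\<in>M. norm (A x) < \<delta>) \<longrightarrow> measure lebesgue M \<le> C * \<delta>\<^sup>2)" for p r and C :: real
  have "\<exists>r C. 0 < r \<and> 0 \<le> C \<and> Q p r C" if "p \<in> K" for p
  proof -
    have p: "p \<in> \<Omega>" using that K by auto
    then obtain a b where "\<And>s t. D p (s *\<^sub>R a + t *\<^sub>R b) = 0 \<Longrightarrow> s = 0 \<and> t = 0" using rank by blast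
    then show ?thesis unfolding Q_def by (intro rank_two_local_measure[OF \<Omega> p A D]) auto
  qed
  then obtain r C where rC: "\<And>p. p \<in> K \<Longrightarrow> 0 < r p" "\<And>p. p \<in> K \<Longrightarrow> 0 \<le> C p"
    "\<And>p. p \<in> K \<Longrightarrow> Q p (r p) (C p)"
    by metis
  obtain P where P: "P \<subseteq> K" "finite P" "K \<subseteq> (\<Union>p\<in>P. ball p (r p))"
  proof (rule compactE_image[OF K(1), of K "\<lambda>p. ball p (r p)"])
    show "K \<subseteq> (\<Union>p\<in>K. ball p (r p))" using rC(1) by (auto intro!: bexI)
  qed auto
  show ?thesis
  proof
    show "0 \<le> sum C P" using rC(2) P(1) by (auto intro: sum_nonneg)
    fix \<delta> :: real assume \<delta>: "0 < \<delta>" "\<delta> \<le> 1"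
    show "{x\<in>K. norm (A x) < \<delta>} \<in> lmeasurable" by (rule meas)
    let ?M = "\<lambda>p. {x\<in>K. norm (A x) < \<delta>} \<inter> ball p (r p)"
    have m: "?M p \<in> lmeasurable" for p by (intro fmeasurable.Int meas lmeasurable_ball)
    have "measure lebesgue {x\<in>K. norm (A x) < \<delta>} = measure lebesgue (\<Union>p\<in>P. ?M p)"
      using P(3) by (intro arg_cong[where f = "measure lebesgue"]) auto
    also have "\<dots> \<le> (\<Sum>p\<in>P. measure lebesgue (?M p))"
      using P(2) m by (intro measure_UNION_le) auto
    also have "\<dots> \<le> (\<Sum>p\<in>P. C p * \<delta>\<^sup>2)"
    proof (rule sum_mono)
      fix p assume "p \<in> P"
      then have "Q p (r p) (C p)" using P(1) rC(3) by blast
      then show "measure lebesgue (?M p) \<le> C p * \<delta>\<^sup>2"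
        unfolding Q_def using \<delta> m K(2) by (elim allE[of _ \<delta>] allE[of _ "?M p"] impE) auto
    qed
    finally show "measure lebesgue {x\<in>K. norm (A x) < \<delta>} \<le> sum C P * \<delta>\<^sup>2"
      by (simp add: sum_distrib_right)
  qed
qed

subsection \<open>Integral of a compactly supported divergence\<close>

lemma lborel_integral_translation:
  fixes g :: "'a::euclidean_space \<Rightarrow> real"
  assumes "g \<in> borel_measurable borel"
  shows "(\<integral>x. g (c + x) \<partial>lborel) = (\<integral>x. g x \<partial>lborel)"
    and "integrable lborel (\<lambda>x. g (c + x)) \<longleftrightarrow> integrable lborel g"
proof -
  have "(\<integral>x. g x \<partial>lborel) = (\<integral>x. g x \<partial>distr lborel borel ((+) c))"
    by (simp add: lborel_distr_plus)
  also have "\<dots> = (\<integral>x. g (c + x) \<partial>lborel)"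
    using assms by (intro integral_distr) auto
  finally show "(\<integral>x. g (c + x) \<partial>lborel) = (\<integral>x. g x \<partial>lborel)" ..
  have "integrable lborel g \<longleftrightarrow> integrable (distr lborel borel ((+) c)) g"
    by (simp add: lborel_distr_plus)
  also have "\<dots> \<longleftrightarrow> integrable lborel (\<lambda>x. g (c + x))"
    using assms by (intro integrable_distr_eq) auto
  finally show "integrable lborel (\<lambda>x. g (c + x)) \<longleftrightarrow> integrable lborel g" ..
qed

text \<open>Difference quotients have integral 0 by translation invariance and converge to the
  directional derivative; dominated convergence passes to the limit. Measurability of the derivative
  also comes from this limit, so boundedness can stand in for its continuity.\<close>

lemma integral_directional_derivative_eq_0:
  fixes g :: "'a::euclidean_space \<Rightarrow> real"
  assumes g: "\<And>x. (g has_derivative g' x) (at x)"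
    and B: "\<And>x. \<bar>g' x b\<bar> \<le> B"
    and R: "\<And>x. R < norm x \<Longrightarrow> g x = 0"
  shows "has_bochner_integral lborel (\<lambda>x. g' x b) 0"
proof -
  have contg: "continuous_on S g" for S
    using g by (meson has_derivative_continuous continuous_at_imp_continuous_on)
  have meas: "g \<in> borel_measurable borel"
    using contg by (rule borel_measurable_continuous_onI)
  have "integrable lborel (\<lambda>x. indicator (cball 0 R) x *\<^sub>R g x)"
    by (intro borel_integrable_compact contg) auto
  also have "(\<lambda>x. indicator (cball 0 R) x *\<^sub>R g x) = g"
    using R by (force simp: indicator_def)
  finally have int: "integrable lborel g" .
  define s where "s n x = (g (inverse (real (Suc n)) *\<^sub>R b + x) - g x) * real (Suc n)" for n x
  have s0: "integral\<^sup>L lborel (s n) = 0" for n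
  proof -
    have "integral\<^sup>L lborel (s n) =
        (\<integral>x. g (inverse (real (Suc n)) *\<^sub>R b + x) - g x \<partial>lborel) * real (Suc n)"
      unfolding s_def by (rule integral_mult_left_zero)
    also have "(\<integral>x. g (inverse (real (Suc n)) *\<^sub>R b + x) - g x \<partial>lborel) = 0"
      using int by (subst Bochner_Integration.integral_diff)
        (simp_all add: lborel_integral_translation[OF meas])
    finally show ?thesis by simp
  qed
  have lim: "(\<lambda>n. s n x) \<longlonglongrightarrow> g' x b" for x
  proof -
    interpret bounded_linear "g' x" using g by (rule has_derivative_bounded_linear)
    have "((\<lambda>t. g (t *\<^sub>R b + x)) has_derivative (\<lambda>t. g' (0 *\<^sub>R b + x) (t *\<^sub>R b))) (at 0)"
      by (rule derivative_eq_intros has_derivative_compose[where g = g, OF _ g] refl)+ simp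
    then have "((\<lambda>t. g (t *\<^sub>R b + x)) has_derivative (\<lambda>t. t * g' x b)) (at 0)"
      by (simp add: scaleR)
    then have "((\<lambda>t. g (t *\<^sub>R b + x)) has_field_derivative g' x b) (at 0)"
      by (simp add: has_field_derivative_def mult_commute_abs)
    then have "((\<lambda>t. (g (t *\<^sub>R b + x) - g x) / t) \<longlongrightarrow> g' x b) (at 0)"
      by (simp add: DERIV_def)
    moreover have "filterlim (\<lambda>n. inverse (real (Suc n))) (at 0) sequentially"
      using LIMSEQ_inverse_real_of_nat by (simp add: filterlim_at)
    ultimately have "(\<lambda>n. (g (inverse (real (Suc n)) *\<^sub>R b + x) - g x) / inverse (real (Suc n)))
        \<longlonglongrightarrow> g' x b"
      by (rule filterlim_compose)
    then show ?thesis by (simp add: s_def divide_inverse)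
  qed
  have meas_s: "s n \<in> borel_measurable lborel" for n
    unfolding s_def using meas by measurable
  have meas': "(\<lambda>x. g' x b) \<in> borel_measurable lborel"
    using lim meas_s by (rule borel_measurable_LIMSEQ_real)
  \<comment> \<open>The increments have length at most \<open>norm b\<close>, so every quotient
    vanishes outside the enlarged ball; inside it the mean value theorem gives the bound
    \<open>B\<close>.\<close>
  have bound: "norm (s n x) \<le> indicator (cball 0 (R + norm b)) x *\<^sub>R B" for n x
  proof -
    define t where "t = inverse (real (Suc n))"
    have t: "0 < t" "t \<le> 1" by (auto simp: t_def field_simps)
    show ?thesis
    proof (cases "x \<in> cball 0 (R + norm b)")
      case True
      have "((\<lambda>t. g (t *\<^sub>R b + x)) has_derivative (\<lambda>r. g' (u *\<^sub>R b + x) (r *\<^sub>R b))) (at u within {0..t})" for u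
        by (rule derivative_eq_intros has_derivative_compose[where g = g, OF _ g] refl)+ simp
      then obtain u where "g (t *\<^sub>R b + x) - g (0 *\<^sub>R b + x) = g' (u *\<^sub>R b + x) ((t - 0) *\<^sub>R b)"
        using mvt_simple[of 0 t "\<lambda>t. g (t *\<^sub>R b + x)" "\<lambda>u r. g' (u *\<^sub>R b + x) (r *\<^sub>R b)"] t by blast
      then have "g (t *\<^sub>R b + x) - g x = t * g' (u *\<^sub>R b + x) b"
        using linear_scale[OF has_derivative_linear[OF g]] by simp
      then have "s n x = g' (u *\<^sub>R b + x) b"
        by (simp add: s_def t_def[symmetric]) (simp add: t_def)
      then show ?thesis using True B by simp
    next
      case False
      then have x: "R + norm b < norm x" by simp
      have "norm x \<le> norm (t *\<^sub>R b + x) + norm (t *\<^sub>R b)"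
        using norm_triangle_ineq4[of "t *\<^sub>R b + x" "t *\<^sub>R b"] by simp
      moreover have "norm (t *\<^sub>R b) \<le> norm b" using t by (simp add: mult_left_le_one_le)
      ultimately have "R < norm (t *\<^sub>R b + x)" using x by simp
      moreover have "R < norm x" using x by (smt (verit) norm_ge_zero)
      ultimately show ?thesis using False R by (simp add: s_def t_def)
    qed
  qed
  have dom: "integrable lborel (\<lambda>x::'a. indicator (cball 0 (R + norm b)) x *\<^sub>R B)"
    by (intro borel_integrable_compact) auto
  have "integrable lborel (\<lambda>x. g' x b)"
    by (rule integrable_dominated_convergence[where s = s, OF meas' meas_s dom]) (use lim bound in auto)
  moreover have "(\<lambda>n. integral\<^sup>L lborel (s n)) \<longlonglongrightarrow> (\<integral>x. g' x b \<partial>lborel)"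
    by (rule integral_dominated_convergence[where s = s, OF meas' meas_s dom]) (use lim bound in auto)
  then have "(\<integral>x. g' x b \<partial>lborel) = 0"
    unfolding s0 by (simp add: LIMSEQ_const_iff)
  ultimately show ?thesis by (simp add: has_bochner_integral_iff)
qed

lemma integral_divergence_eq_0:
  fixes f :: "'a::euclidean_space \<Rightarrow> 'a"
  assumes f: "\<And>x. (f has_derivative f' x) (at x)"
    and B: "\<And>x b. b \<in> Basis \<Longrightarrow> norm (f' x b) \<le> B"
    and R: "\<And>x. R < norm x \<Longrightarrow> f x = 0"
  shows "has_bochner_integral lborel (\<lambda>x. \<Sum>b\<in>Basis. f' x b \<bullet> b) 0"
proof -
  have "has_bochner_integral lborel (\<lambda>x. f' x b \<bullet> b) 0" if b: "b \<in> Basis" for b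
  proof (rule integral_directional_derivative_eq_0[where g = "\<lambda>x. f x \<bullet> b"
        and g' = "\<lambda>x h. f' x h \<bullet> b" and B = B and R = R])
    show "((\<lambda>x. f x \<bullet> b) has_derivative (\<lambda>h. f' x h \<bullet> b)) (at x)" for x
      by (intro has_derivative_inner_left f)
    show "\<bar>f' x b \<bullet> b\<bar> \<le> B" for x
      using Basis_le_norm[OF b, of "f' x b"] B[OF b, of x] by linarith
    show "f x \<bullet> b = 0" if "R < norm x" for x using R[OF that] by simp
  qed
  then have "has_bochner_integral lborel (\<lambda>x. \<Sum>b\<in>Basis. f' x b \<bullet> b) (\<Sum>b\<in>(Basis::'a set). 0)"
    by (intro has_bochner_integral_sum) auto
  then show ?thesis by simp
qed

section \<open>Cutoff functions of class C1\<close>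

text \<open>Squaring makes the positive part continuously differentiable. The function serves both
  as the weight in \<open>w - e\<close> and as the building block of \<open>cutoff\<close>.\<close>

definition ramp_sq :: "real \<Rightarrow> real" where
  "ramp_sq t = (max 0 t)\<^sup>2"

lemma ramp_sq_deriv: "(ramp_sq has_real_derivative 2 * max 0 t) (at t)"
proof (cases t "0::real" rule: linorder_cases)
  case less
  then have "\<forall>\<^sub>F x in nhds t. x \<in> {..<0}" by (intro eventually_nhds_in_open) auto
  then have "\<forall>\<^sub>F x in nhds t. ramp_sq x = 0" by eventually_elim (auto simp: ramp_sq_def max_def)
  then have "DERIV ramp_sq t :> 0 \<longleftrightarrow> DERIV (\<lambda>x. 0) t :> 0"
    by (intro DERIV_cong_ev refl)
  then show ?thesis using less by (simp add: max_def)
next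
  case greater
  then have "\<forall>\<^sub>F x in nhds t. x \<in> {0<..}" by (intro eventually_nhds_in_open) auto
  then have "\<forall>\<^sub>F x in nhds t. ramp_sq x = x\<^sup>2" by eventually_elim (auto simp: ramp_sq_def max_def)
  then have "DERIV ramp_sq t :> 2 * t \<longleftrightarrow> DERIV (\<lambda>x. x\<^sup>2) t :> 2 * t"
    by (intro DERIV_cong_ev refl)
  moreover have "DERIV (\<lambda>x. x\<^sup>2) t :> 2 * t"
    by (auto intro!: derivative_eq_intros)
  ultimately show ?thesis using greater by (simp add: max_def)
next
  case equal
  have "((\<lambda>h. max 0 h * max 0 h / h) \<longlongrightarrow> 0) (at (0::real))"
  proof (rule Lim_null_comparison)
    show "\<forall>\<^sub>F h in at (0::real). norm (max 0 h * max 0 h / h) \<le> \<bar>h\<bar>"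
      by (rule always_eventually) (auto simp: max_def)
    show "((\<lambda>h. \<bar>h\<bar>) \<longlongrightarrow> 0) (at (0::real))" by (auto intro!: tendsto_eq_intros)
  qed
  then show ?thesis using equal by (simp add: DERIV_def ramp_sq_def power2_eq_square)
qed

lemma ramp_sq_nonneg: "0 \<le> ramp_sq t"
  by (simp add: ramp_sq_def)

text \<open>A \<open>C\<^sup>1\<close> step from 0 (for \<open>s \<le> 1\<close>) to 1 (for \<open>s \<ge> 2\<close>).\<close>

definition cutoff :: "real \<Rightarrow> real" where
  "cutoff s = 1 - ramp_sq (1 - ramp_sq (s - 1))"

definition cutoff' :: "real \<Rightarrow> real" where
  "cutoff' s = 2 * max 0 (1 - ramp_sq (s - 1)) * (2 * max 0 (s - 1))"

lemma cutoff_deriv: "(cutoff has_real_derivative cutoff' s) (at s)"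
  unfolding cutoff_def[abs_def] cutoff'_def
  by (rule derivative_eq_intros DERIV_chain2[OF ramp_sq_deriv] refl)+ simp

lemma cutoff_bounds: "0 \<le> cutoff s" "cutoff s \<le> 1"
proof -
  have "ramp_sq (1 - ramp_sq (s - 1)) \<le> 1"
    using ramp_sq_nonneg[of "s - 1"] unfolding ramp_sq_def[of "1 - _"]
    by (intro power_le_one) auto
  then show "0 \<le> cutoff s" "cutoff s \<le> 1"
    using ramp_sq_nonneg by (auto simp: cutoff_def)
qed

lemma cutoff_eq_0: "s \<le> 1 \<Longrightarrow> cutoff s = 0"
  by (simp add: cutoff_def ramp_sq_def)

lemma cutoff_eq_1:
  assumes "2 \<le> s" shows "cutoff s = 1"
proof -
  have "1 \<le> (s - 1)\<^sup>2" using assms by simp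
  then show ?thesis using assms by (simp add: cutoff_def ramp_sq_def)
qed

text \<open>Outside the open interval from 1 to 2 a factor of \<open>cutoff'\<close> vanishes;
  inside it both \<open>max\<close> terms are at most 1.\<close>

lemma cutoff'_bound: "\<bar>cutoff' s\<bar> \<le> (if 1 < s \<and> s < 2 then 4 else 0)"
proof (cases "1 < s \<and> s < 2")
  case True
  have "max 0 (1 - ramp_sq (s - 1)) * max 0 (s - 1) \<le> 1 * 1"
    using True ramp_sq_nonneg[of "s - 1"] by (intro mult_mono) auto
  moreover have "0 \<le> max 0 (1 - ramp_sq (s - 1)) * max 0 (s - 1)" by simp
  moreover have "cutoff' s = 4 * (max 0 (1 - ramp_sq (s - 1)) * max 0 (s - 1))"
    by (simp add: cutoff'_def)
  ultimately show ?thesis using True by simp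
next
  case False
  have "1 - ramp_sq (s - 1) \<le> 0" if "2 \<le> s"
    using that by (simp add: ramp_sq_def)
  then show ?thesis using False by (auto simp: cutoff'_def not_less)
qed

lemma continuous_cutoff [continuous_intros]:
  "continuous_on X f \<Longrightarrow> continuous_on X (\<lambda>x. cutoff (f x))"
  "continuous_on X f \<Longrightarrow> continuous_on X (\<lambda>x. cutoff' (f x))"
  unfolding cutoff_def cutoff'_def ramp_sq_def by (intro continuous_intros; assumption)+

subsection \<open>The comparison argument\<close>

text \<open>For \<open>a \<noteq> 0\<close> this is the derivative of \<open>sgn\<close> at
  \<open>a\<close>: the part of \<open>d\<close> orthogonal to \<open>a\<close>, divided by
  \<open>norm a\<close>.\<close>

definition sgn_deriv :: "'a::real_inner \<Rightarrow> 'a \<Rightarrow> 'a" where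
  "sgn_deriv a d = d /\<^sub>R norm a - (a \<bullet> d / norm a ^ 3) *\<^sub>R a"

lemma has_derivative_sgn:
  fixes A :: "'a::real_normed_vector \<Rightarrow> 'b::real_inner"
  assumes A: "(A has_derivative A') (at x)" and "A x \<noteq> 0"
  shows "((\<lambda>x. sgn (A x)) has_derivative (\<lambda>h. sgn_deriv (A x) (A' h))) (at x)"
proof -
  have "((\<lambda>x. norm (A x)) has_derivative (\<lambda>h. A' h \<bullet> sgn (A x))) (at x)"
    by (rule has_derivative_compose[OF A has_derivative_norm[OF assms(2)]])
  from has_derivative_scaleR[OF Deriv.has_derivative_inverse[OF _ this] A]
  have "((\<lambda>x. sgn (A x)) has_derivative (\<lambda>h. inverse (norm (A x)) *\<^sub>R A' h
      + (- (inverse (norm (A x)) * (A' h \<bullet> sgn (A x)) * inverse (norm (A x)))) *\<^sub>R A x)) (at x)"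
    using assms(2) by (simp add: sgn_div_norm)
  also have "(\<lambda>h. inverse (norm (A x)) *\<^sub>R A' h
      + (- (inverse (norm (A x)) * (A' h \<bullet> sgn (A x)) * inverse (norm (A x)))) *\<^sub>R A x)
    = (\<lambda>h. sgn_deriv (A x) (A' h))"
    using assms(2)
    by (simp add: fun_eq_iff sgn_deriv_def sgn_div_norm inner_commute divide_inverse power3_eq_cube)
  finally show ?thesis .
qed

lemma continuous_on_sgn_deriv [continuous_intros]:
  "continuous_on S A \<Longrightarrow> continuous_on S D \<Longrightarrow> (\<And>x. x \<in> S \<Longrightarrow> A x \<noteq> 0) \<Longrightarrow>
    continuous_on S (\<lambda>x. sgn_deriv (A x) (D x))"
  unfolding sgn_deriv_def by (intro continuous_intros) auto

text \<open>With \<open>c\<close> the cosine of the angle, the left-hand side is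
  \<open>(norm a + norm b) * (1 - c)\<close>, and \<open>1 - c\<close> is half the squared distance
  of the unit vectors. Hence it is positive unless the directions agree.\<close>

lemma inner_diff_sgn:
  fixes a b :: "'a::real_inner"
  assumes "a \<noteq> 0" "b \<noteq> 0"
  shows "(a - b) \<bullet> (sgn a - sgn b) = (norm a + norm b) / 2 * (norm (sgn a - sgn b))\<^sup>2"
proof -
  define c where "c = sgn a \<bullet> sgn b"
  have a: "a = norm a *\<^sub>R sgn a" and b: "b = norm b *\<^sub>R sgn b"
    using assms by (simp_all add: sgn_div_norm)
  have 1: "sgn a \<bullet> sgn a = 1" "sgn b \<bullet> sgn b = 1"
    using assms by (simp_all add: dot_square_norm norm_sgn)
  have "(a - b) \<bullet> (sgn a - sgn b)
      = (norm a *\<^sub>R sgn a - norm b *\<^sub>R sgn b) \<bullet> (sgn a - sgn b)"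
    using a b by metis
  also have "\<dots> = (norm a + norm b) * (1 - c)"
    by (simp add: inner_diff 1 c_def[symmetric] inner_commute[of "sgn b" "sgn a"] algebra_simps)
  also have "1 - c = (norm (sgn a - sgn b))\<^sup>2 / 2"
    by (simp add: power2_norm_eq_inner inner_diff 1 c_def[symmetric] inner_commute[of "sgn b" "sgn a"])
  finally show ?thesis by simp
qed

text \<open>The convention \<open>sgn 0 = 0\<close> extends the sign to singular points, so the main
  integrand is nonnegative there too.\<close>

lemma inner_diff_sgn_nonneg:
  fixes a b :: "'a::real_inner"
  shows "0 \<le> (a - b) \<bullet> (sgn a - sgn b)"
proof (cases "a = 0 \<or> b = 0")
  case True
  then show ?thesis by (auto simp: sgn_div_norm)
next
  case False
  then show ?thesis by (subst inner_diff_sgn) auto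
qed

lemma sum_Basis_linear:
  fixes l :: "'a::euclidean_space \<Rightarrow> real"
  assumes "linear l"
  shows "(\<Sum>b\<in>Basis. l b * (G \<bullet> b)) = l G"
proof -
  have "l G = l (\<Sum>b\<in>Basis. (G \<bullet> b) *\<^sub>R b)" by (simp add: euclidean_representation)
  also have "\<dots> = (\<Sum>b\<in>Basis. (G \<bullet> b) * l b)"
    using assms by (simp add: linear_sum linear_scale)
  finally show ?thesis by (simp add: mult.commute)
qed

text \<open>\<open>cutoff'\<close> is nonzero only if its argument lies between 1 and 2, which
  forces \<open>norm a < \<delta>\<close>. Cauchy-Schwarz then gives
  \<open>4 * (4 / \<delta>\<^sup>2) * (2 * (\<delta> * (2 * M)))\<close>, which is
  \<open>64 * M / \<delta>\<close>.\<close>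

lemma cutoff_term_bound:
  fixes a d :: "'a::real_inner"
  assumes "0 < \<delta>" "0 \<le> M" "norm d \<le> 2 * M"
  shows "\<bar>cutoff' (4 / \<delta>\<^sup>2 * (a \<bullet> a)) * (4 / \<delta>\<^sup>2 * (2 * (a \<bullet> d)))\<bar> \<le> 64 * M / \<delta> * of_bool (norm a < \<delta>)"
proof (cases "cutoff' (4 / \<delta>\<^sup>2 * (a \<bullet> a)) = 0")
  case False
  have c4: "\<bar>cutoff' (4 / \<delta>\<^sup>2 * (a \<bullet> a))\<bar> \<le> 4" and "4 / \<delta>\<^sup>2 * (a \<bullet> a) < 2"
    using cutoff'_bound[of "4 / \<delta>\<^sup>2 * (a \<bullet> a)"] False by (auto split: if_splits)
  then have "4 * (norm a)\<^sup>2 < 2 * \<delta>\<^sup>2"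
    using assms(1) by (simp add: power2_norm_eq_inner field_simps)
  then have "(norm a)\<^sup>2 < \<delta>\<^sup>2" using zero_le_power2[of "norm a"] by linarith
  then have a: "norm a < \<delta>" using assms(1) by (simp add: power2_less_imp_less)
  have "\<bar>a \<bullet> d\<bar> \<le> norm a * norm d" by (rule Cauchy_Schwarz_ineq2)
  also have "\<dots> \<le> \<delta> * (2 * M)" using a assms by (intro mult_mono) auto
  finally have "\<bar>4 / \<delta>\<^sup>2 * (2 * (a \<bullet> d))\<bar> \<le> 4 / \<delta>\<^sup>2 * (2 * (\<delta> * (2 * M)))"
    unfolding abs_mult using assms(1) by (intro mult_mono) auto
  also have "\<dots> = 16 * M / \<delta>" using assms(1) by (simp add: field_simps power2_eq_square)
  finally have "\<bar>cutoff' (4 / \<delta>\<^sup>2 * (a \<bullet> a))\<bar> * \<bar>4 / \<delta>\<^sup>2 * (2 * (a \<bullet> d))\<bar> \<le> 4 * (16 * M / \<delta>)"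
    using c4 by (intro mult_mono) auto
  then show ?thesis using a by (simp add: abs_mult)
qed (use assms in auto)

text \<open>In the application \<^term>\<open>A\<close> and \<^term>\<open>B\<close> are the fields \<open>\<nabla>u + F\<close> and \<open>\<nabla>v + F\<close>,
  and \<open>w = u - v\<close>; the rank conditions say that their zero sets have codimension at least 2.\<close>

locale comparison =
  fixes \<Omega> :: "'a::euclidean_space set" and w :: "'a \<Rightarrow> real" and A B DA DB
  assumes open_\<Omega>: "open \<Omega>"
    and compact_K: "\<And>e. 0 < e \<Longrightarrow> compact {x\<in>\<Omega>. e \<le> w x}"
    and dw: "\<And>x. x \<in> \<Omega> \<Longrightarrow> (w has_derivative (\<lambda>h. (A x - B x) \<bullet> h)) (at x)"
    and dA: "\<And>x. x \<in> \<Omega> \<Longrightarrow> (A has_derivative DA x) (at x)"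
    and dB: "\<And>x. x \<in> \<Omega> \<Longrightarrow> (B has_derivative DB x) (at x)"
    and cDA: "\<And>h. continuous_on \<Omega> (\<lambda>x. DA x h)"
    and cDB: "\<And>h. continuous_on \<Omega> (\<lambda>x. DB x h)"
    and rankA: "\<And>x. x \<in> \<Omega> \<Longrightarrow> \<exists>a b. \<forall>s t. DA x (s *\<^sub>R a + t *\<^sub>R b) = 0 \<longrightarrow> s = 0 \<and> t = 0"
    and rankB: "\<And>x. x \<in> \<Omega> \<Longrightarrow> \<exists>a b. \<forall>s t. DB x (s *\<^sub>R a + t *\<^sub>R b) = 0 \<longrightarrow> s = 0 \<and> t = 0"
    and div_le: "\<And>x. x \<in> \<Omega> \<Longrightarrow> A x \<noteq> 0 \<Longrightarrow> B x \<noteq> 0 \<Longrightarrow>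
      (\<Sum>b\<in>Basis. sgn_deriv (B x) (DB x b) \<bullet> b) \<le> (\<Sum>b\<in>Basis. sgn_deriv (A x) (DA x b) \<bullet> b)"
begin

lemma cA: "continuous_on \<Omega> A" and cB: "continuous_on \<Omega> B" and cw: "continuous_on \<Omega> w"
  using dA dB dw by (meson has_derivative_continuous continuous_at_imp_continuous_on)+

text \<open>\<open>F\<close> is the divergence of the ramp in \<open>w - e\<close> times two cutoffs
  times \<open>sgn A - sgn B\<close>. Differentiating the ramp gives the main term, differentiating
  a cutoff gives an error of order \<open>1 / \<delta>\<close> where that field is below
  \<open>\<delta>\<close>, and the divergence of the unit fields contributes a nonnegative term by
  \<open>div_le\<close>.\<close>

lemma flux_inequality:
  assumes e: "0 < e" and \<delta>: "0 < \<delta>" and "0 \<le> M"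
    and MA: "\<And>x h. x \<in> \<Omega> \<Longrightarrow> e \<le> w x \<Longrightarrow> norm (DA x h) \<le> M * norm h"
    and MB: "\<And>x h. x \<in> \<Omega> \<Longrightarrow> e \<le> w x \<Longrightarrow> norm (DB x h) \<le> M * norm h"
    and \<Phi>: "\<And>x. x \<in> \<Omega> \<Longrightarrow> e \<le> w x \<Longrightarrow> ramp_sq (w x - e) \<le> \<Phi>"
  shows "\<exists>F. has_bochner_integral lborel F 0 \<and> (\<forall>x. x \<notin> {x\<in>\<Omega>. e \<le> w x} \<longrightarrow> F x = 0) \<and>
     (\<forall>x\<in>{x\<in>\<Omega>. e \<le> w x}. 2 * max 0 (w x - e) * ((A x - B x) \<bullet> (sgn (A x) - sgn (B x)))
          * cutoff (4 / \<delta>\<^sup>2 * (A x \<bullet> A x)) * cutoff (4 / \<delta>\<^sup>2 * (B x \<bullet> B x))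
        - \<Phi> * (64 * M / \<delta>) * (of_bool (norm (A x) < \<delta>) + of_bool (norm (B x) < \<delta>)) \<le> F x)"
proof -
  define \<kappa> where "\<kappa> = 4 / \<delta>\<^sup>2"
  \<comment> \<open>A cutoff vanishes where its field is below \<open>\<delta> / 2\<close>, and the
    ramp where \<open>w \<le> e\<close>. So within \<open>\<Omega>\<close> the weight
    \<open>P\<close> lives on this compact set, where both unit fields are differentiable.\<close>
  define K where "K = {x\<in>{x\<in>{x\<in>\<Omega>. e \<le> w x}. \<delta> / 2 \<le> norm (A x)}. \<delta> / 2 \<le> norm (B x)}"
  define c\<^sub>A where "c\<^sub>A x = cutoff (\<kappa> * (A x \<bullet> A x))" for x
  define c\<^sub>B where "c\<^sub>B x = cutoff (\<kappa> * (B x \<bullet> B x))" for x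
  define c\<^sub>A' where "c\<^sub>A' x h = cutoff' (\<kappa> * (A x \<bullet> A x)) * (\<kappa> * (2 * (A x \<bullet> DA x h)))" for x h
  define c\<^sub>B' where "c\<^sub>B' x h = cutoff' (\<kappa> * (B x \<bullet> B x)) * (\<kappa> * (2 * (B x \<bullet> DB x h)))" for x h
  define R where "R x = ramp_sq (w x - e)" for x
  define R' where "R' x h = 2 * max 0 (w x - e) * ((A x - B x) \<bullet> h)" for x h
  define P where "P x = R x * c\<^sub>A x * c\<^sub>B x" for x
  define P' where "P' x h = R' x h * c\<^sub>A x * c\<^sub>B x + R x * c\<^sub>A' x h * c\<^sub>B x + R x * c\<^sub>A x * c\<^sub>B' x h" for x h
  define G where "G x = sgn (A x) - sgn (B x)" for x
  define G' where "G' x h = sgn_deriv (A x) (DA x h) - sgn_deriv (B x) (DB x h)" for x h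
  define f where "f x = (if x \<in> K then P x *\<^sub>R G x else 0)" for x
  define f' where "f' x h = (if x \<in> K then P x *\<^sub>R G' x h + P' x h *\<^sub>R G x else 0)" for x h
  have K\<Omega>: "K \<subseteq> \<Omega>" by (auto simp: K_def)
  have compK: "compact K"
    unfolding K_def using e cA cB
    by (intro compact_superlevel compact_K continuous_intros) (auto elim: continuous_on_subset)
  have nz: "A x \<noteq> 0" "B x \<noteq> 0" if "x \<in> K" for x
    using that \<delta> by (auto simp: K_def)
  have small: "\<kappa> * (a \<bullet> a) \<le> 1" if "norm a < \<delta> / 2" for a :: 'a
  proof -
    have "(norm a)\<^sup>2 \<le> (\<delta> / 2)\<^sup>2" using that by (intro power_mono) auto
    then show ?thesis using \<delta> by (simp add: \<kappa>_def power2_norm_eq_inner field_simps)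
  qed
  have c0: "c\<^sub>A x = 0 \<or> c\<^sub>B x = 0" if "x \<in> \<Omega>" "e \<le> w x" "x \<notin> K" for x
    using that small[of "A x"] small[of "B x"]
    by (auto simp: K_def c\<^sub>A_def c\<^sub>B_def not_le intro: cutoff_eq_0)
  have P0: "P x = 0" if "x \<in> \<Omega>" "x \<notin> K" for x
    using c0[of x] that by (cases "e \<le> w x") (auto simp: P_def R_def ramp_sq_def)
  have dR: "(R has_derivative R' x) (at x)" if "x \<in> \<Omega>" for x
  proof -
    have "((\<lambda>x. w x - e) has_derivative (\<lambda>h. (A x - B x) \<bullet> h)) (at x)"
      using has_derivative_diff[OF dw[OF that] has_derivative_const[of e]] by simp
    from has_derivative_compose[OF this ramp_sq_deriv[unfolded has_field_derivative_def]]
    show ?thesis by (simp add: R_def[abs_def] R'_def[abs_def])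
  qed
  have dc: "((\<lambda>x. cutoff (\<kappa> * (A x \<bullet> A x))) has_derivative
      (\<lambda>h. cutoff' (\<kappa> * (A x \<bullet> A x)) * (\<kappa> * (2 * (A x \<bullet> A' h))))) (at x)"
    if "(A has_derivative A') (at x)" for A :: "'a \<Rightarrow> 'a" and A' x
  proof -
    have "((\<lambda>x. \<kappa> * (A x \<bullet> A x)) has_derivative (\<lambda>h. \<kappa> * (2 * (A x \<bullet> A' h)))) (at x)"
      using has_derivative_mult_right[OF has_derivative_inner[OF that that]]
      by (simp add: inner_commute algebra_simps)
    from has_derivative_compose[OF this cutoff_deriv[unfolded has_field_derivative_def]]
    show ?thesis .
  qed
  have dP: "(P has_derivative P' x) (at x)" if "x \<in> \<Omega>" for x
  proof -
    have "(c\<^sub>A has_derivative c\<^sub>A' x) (at x)" "(c\<^sub>B has_derivative c\<^sub>B' x) (at x)"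
      using dc[OF dA[OF that]] dc[OF dB[OF that]]
      by (simp_all add: c\<^sub>A_def[abs_def] c\<^sub>A'_def[abs_def] c\<^sub>B_def[abs_def] c\<^sub>B'_def[abs_def])
    from has_derivative_mult[OF has_derivative_mult[OF dR[OF that] this(1)] this(2)]
    show ?thesis by (simp add: P_def[abs_def] P'_def[abs_def] algebra_simps)
  qed
  have dG: "(G has_derivative G' x) (at x)" if "x \<in> K" for x
    using has_derivative_diff[OF has_derivative_sgn[OF dA] has_derivative_sgn[OF dB]] nz[OF that] K\<Omega> that
    by (auto simp: G_def[abs_def] G'_def[abs_def])
  \<comment> \<open>On all of \<open>\<Omega>\<close> the function \<open>f\<close> equals
    \<open>P x *\<^sub>R G x\<close>, since \<open>P\<close> is 0 there off \<open>K\<close>; this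
    settles boundary points of \<open>K\<close>. Off the closed set \<open>K\<close>,
    \<open>f\<close> is locally 0.\<close>
  have df: "(f has_derivative f' x) (at x)" for x
  proof (cases "x \<in> K")
    case True
    then have x: "x \<in> \<Omega>" using K\<Omega> by auto
    have "((\<lambda>x. P x *\<^sub>R G x) has_derivative f' x) (at x)"
      using has_derivative_scaleR[OF dP[OF x] dG[OF True]] True by (simp add: f'_def[abs_def])
    then show ?thesis
      by (rule has_derivative_transform_within_open[OF _ open_\<Omega> x]) (auto simp: f_def P0)
  next
    case False
    have "((\<lambda>x. 0) has_derivative f' x) (at x)" using False by (simp add: f'_def[abs_def])
    then show ?thesis
      by (rule has_derivative_transform_within_open[of _ _ _ _ "- K"])
        (use compK False in \<open>auto simp: f_def compact_imp_closed open_Compl\<close>)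
  qed
  have "continuous_on K (\<lambda>x. P x *\<^sub>R G' x b + P' x b *\<^sub>R G x)" for b
    unfolding P_def P'_def G_def G'_def R_def R'_def c\<^sub>A_def c\<^sub>B_def c\<^sub>A'_def c\<^sub>B'_def ramp_sq_def
    using nz
    by (intro continuous_intros continuous_on_subset[OF cA K\<Omega>] continuous_on_subset[OF cB K\<Omega>]
       continuous_on_subset[OF cw K\<Omega>] continuous_on_subset[OF cDA K\<Omega>] continuous_on_subset[OF cDB K\<Omega>]) auto
  then have "continuous_on K (\<lambda>x. \<Sum>b\<in>Basis. norm (P x *\<^sub>R G' x b + P' x b *\<^sub>R G x))"
    by (intro continuous_on_sum continuous_on_norm) auto
  then have "bounded ((\<lambda>x. \<Sum>b\<in>Basis. norm (P x *\<^sub>R G' x b + P' x b *\<^sub>R G x)) ` K)"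
    using compK by (intro compact_imp_bounded compact_continuous_image)
  then obtain C where C: "C > 0" "\<And>x. x \<in> K \<Longrightarrow> \<bar>\<Sum>b\<in>Basis. norm (P x *\<^sub>R G' x b + P' x b *\<^sub>R G x)\<bar> \<le> C"
    unfolding bounded_pos by auto
  have bf: "norm (f' x b) \<le> C" if "b \<in> Basis" for x b
  proof (cases "x \<in> K")
    case True
    have "norm (f' x b) \<le> (\<Sum>b\<in>Basis. norm (P x *\<^sub>R G' x b + P' x b *\<^sub>R G x))"
      using member_le_sum[OF that, of "\<lambda>b. norm (P x *\<^sub>R G' x b + P' x b *\<^sub>R G x)"] True
      by (simp add: f'_def)
    then show ?thesis using C(2)[OF True] by linarith
  qed (use C in \<open>simp add: f'_def\<close>)
  obtain r where r: "\<And>x. x \<in> K \<Longrightarrow> norm x \<le> r"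
    using compact_imp_bounded[OF compK] unfolding bounded_iff by auto
  have f0: "f x = 0" if "r < norm x" for x
    using r[of x] that by (auto simp: f_def)
  have int: "has_bochner_integral lborel (\<lambda>x. \<Sum>b\<in>Basis. f' x b \<bullet> b) 0"
    by (rule integral_divergence_eq_0[OF df bf f0])
  show ?thesis
  proof (intro exI conjI ballI allI impI)
    show "has_bochner_integral lborel (\<lambda>x. \<Sum>b\<in>Basis. f' x b \<bullet> b) 0" by (fact int)
    show "(\<Sum>b\<in>Basis. f' x b \<bullet> b) = 0" if "x \<notin> {x\<in>\<Omega>. e \<le> w x}" for x
    proof -
      have "x \<notin> K" using that by (auto simp: K_def)
      then show ?thesis by (simp add: f'_def)
    qed
    fix x assume "x \<in> {x\<in>\<Omega>. e \<le> w x}"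
    then have x: "x \<in> \<Omega>" "e \<le> w x" by auto
    let ?E = "64 * M / \<delta>"
    have \<Phi>0: "0 \<le> \<Phi>" using \<Phi>[OF x] ramp_sq_nonneg order_trans by blast
    have "R' x (G x) * c\<^sub>A x * c\<^sub>B x
        - \<Phi> * ?E * (of_bool (norm (A x) < \<delta>) + of_bool (norm (B x) < \<delta>)) \<le> (\<Sum>b\<in>Basis. f' x b \<bullet> b)"
    proof (cases "x \<in> K")
      case False
      then show ?thesis
        using c0[OF x False] \<Phi>0 \<open>0 \<le> M\<close> \<delta> by (auto simp: f'_def)
    next
      case True
      have "norm (G x) \<le> 2"
        using norm_triangle_ineq4[of "sgn (A x)" "sgn (B x)"] nz[OF True] by (simp add: G_def norm_sgn)
      then have D: "norm (DA x (G x)) \<le> 2 * M" "norm (DB x (G x)) \<le> 2 * M"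
        using MA[OF x, of "G x"] MB[OF x, of "G x"] mult_left_mono[OF _ \<open>0 \<le> M\<close>, of "norm (G x)" 2]
        by linarith+
      have RcB: "0 \<le> R x * c\<^sub>B x" "R x * c\<^sub>B x \<le> \<Phi>" "0 \<le> R x * c\<^sub>A x" "R x * c\<^sub>A x \<le> \<Phi>"
        using \<Phi>[OF x] \<Phi>0 ramp_sq_nonneg[of "w x - e"] cutoff_bounds
          mult_mono[of "R x" \<Phi> "c\<^sub>B x" 1] mult_mono[of "R x" \<Phi> "c\<^sub>A x" 1]
        by (auto simp: R_def c\<^sub>A_def c\<^sub>B_def)
      have "\<bar>(R x * c\<^sub>B x) * c\<^sub>A' x (G x)\<bar> \<le> \<Phi> * (?E * of_bool (norm (A x) < \<delta>))"
        unfolding abs_mult[of "R x * c\<^sub>B x"] using RcB cutoff_term_bound[OF \<delta> \<open>0 \<le> M\<close> D(1), of "A x"]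
        by (intro mult_mono) (auto simp: c\<^sub>A'_def \<kappa>_def)
      moreover have "\<bar>(R x * c\<^sub>A x) * c\<^sub>B' x (G x)\<bar> \<le> \<Phi> * (?E * of_bool (norm (B x) < \<delta>))"
        unfolding abs_mult[of "R x * c\<^sub>A x"] using RcB cutoff_term_bound[OF \<delta> \<open>0 \<le> M\<close> D(2), of "B x"]
        by (intro mult_mono) (auto simp: c\<^sub>B'_def \<kappa>_def)
      moreover have "P' x (G x) = R' x (G x) * c\<^sub>A x * c\<^sub>B x + (R x * c\<^sub>B x) * c\<^sub>A' x (G x)
          + (R x * c\<^sub>A x) * c\<^sub>B' x (G x)"
        by (simp add: P'_def)
      moreover have "\<Phi> * ?E * (i + j) = \<Phi> * (?E * i) + \<Phi> * (?E * j)" for i j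
        by (simp only: distrib_left mult.assoc)
      ultimately have "R' x (G x) * c\<^sub>A x * c\<^sub>B x
        - \<Phi> * ?E * (of_bool (norm (A x) < \<delta>) + of_bool (norm (B x) < \<delta>)) \<le> P' x (G x)"
        by (smt (verit))
      \<comment> \<open>The divergence of \<open>G\<close> enters with the nonnegative factor
        \<open>P\<close>; \<open>div_le\<close> applies because neither field vanishes on
        \<open>K\<close>.\<close>
      also have "P' x (G x) \<le> P x * (\<Sum>b\<in>Basis. G' x b \<bullet> b) + P' x (G x)"
      proof -
        have "0 \<le> (\<Sum>b\<in>Basis. G' x b \<bullet> b)"
          using div_le[OF x(1)] nz[OF True] by (simp add: G'_def inner_diff_left sum_subtractf)
        moreover have "0 \<le> P x" using RcB(1,3) cutoff_bounds
          by (simp add: P_def c\<^sub>A_def c\<^sub>B_def R_def ramp_sq_nonneg)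
        ultimately show ?thesis by simp
      qed
      \<comment> \<open>The derivative of \<open>P\<close> along \<open>G\<close> is written in
        coordinates, as the second half of the product rule for the divergence of
        \<open>f\<close>.\<close>
      also have "P' x (G x) = (\<Sum>b\<in>Basis. P' x b * (G x \<bullet> b))"
        using sum_Basis_linear[OF has_derivative_linear[OF dP[OF x(1)]]] by simp
      also have "P x * (\<Sum>b\<in>Basis. G' x b \<bullet> b) + \<dots> = (\<Sum>b\<in>Basis. f' x b \<bullet> b)"
        using True by (simp add: f'_def inner_add_left sum.distrib sum_distrib_left)
      finally show ?thesis .
    qed
    then show "2 * max 0 (w x - e) * ((A x - B x) \<bullet> (sgn (A x) - sgn (B x)))
          * cutoff (4 / \<delta>\<^sup>2 * (A x \<bullet> A x)) * cutoff (4 / \<delta>\<^sup>2 * (B x \<bullet> B x))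
        - \<Phi> * (64 * M / \<delta>) * (of_bool (norm (A x) < \<delta>) + of_bool (norm (B x) < \<delta>)) \<le> (\<Sum>b\<in>Basis. f' x b \<bullet> b)"
      by (simp add: R'_def G_def c\<^sub>A_def c\<^sub>B_def \<kappa>_def)
  qed
qed

text \<open>If the directions differ at \<open>p\<close>, the main term exceeds some
  \<open>c > 0\<close> on a ball where both fields stay away from 0 and the cutoffs equal 1 for
  small \<open>\<delta>\<close>. The errors are of order \<open>1 / \<delta>\<close> on sets of
  measure of order \<open>\<delta>\<^sup>2\<close>, so \<open>c * m\<close> is bounded by a multiple
  of \<open>\<delta>\<close>, for every small \<open>\<delta>\<close>.\<close>

lemma sgn_eq:
  assumes p: "p \<in> \<Omega>" "0 < w p" "A p \<noteq> 0" "B p \<noteq> 0"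
  shows "sgn (A p) = sgn (B p)"
proof (rule ccontr)
  assume neq: "sgn (A p) \<noteq> sgn (B p)"
  \<comment> \<open>Half of \<open>w p\<close> puts \<open>p\<close> strictly inside the superlevel
    set, so the ramp has positive slope at \<open>p\<close>.\<close>
  define e where "e = w p / 2"
  have e: "0 < e" "e < w p" using p by (auto simp: e_def)
  define K where "K = {x\<in>\<Omega>. e \<le> w x}"
  have K: "compact K" "K \<subseteq> \<Omega>" using compact_K[OF e(1)] by (auto simp: K_def)
  define S\<^sub>A where "S\<^sub>A \<delta> = {x\<in>K. norm (A x) < \<delta>}" for \<delta>
  define S\<^sub>B where "S\<^sub>B \<delta> = {x\<in>K. norm (B x) < \<delta>}" for \<delta>
  obtain C\<^sub>A where C\<^sub>A: "0 \<le> C\<^sub>A" "\<And>\<delta>. 0 < \<delta> \<Longrightarrow> \<delta> \<le> 1 \<Longrightarrow> S\<^sub>A \<delta> \<in> lmeasurable"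
    "\<And>\<delta>. 0 < \<delta> \<Longrightarrow> \<delta> \<le> 1 \<Longrightarrow> measure lebesgue (S\<^sub>A \<delta>) \<le> C\<^sub>A * \<delta>\<^sup>2"
    using rank_two_sublevel_measure[OF open_\<Omega> dA cDA rankA K] unfolding S\<^sub>A_def by blast
  obtain C\<^sub>B where C\<^sub>B: "0 \<le> C\<^sub>B" "\<And>\<delta>. 0 < \<delta> \<Longrightarrow> \<delta> \<le> 1 \<Longrightarrow> S\<^sub>B \<delta> \<in> lmeasurable"
    "\<And>\<delta>. 0 < \<delta> \<Longrightarrow> \<delta> \<le> 1 \<Longrightarrow> measure lebesgue (S\<^sub>B \<delta>) \<le> C\<^sub>B * \<delta>\<^sup>2"
    using rank_two_sublevel_measure[OF open_\<Omega> dB cDB rankB K] unfolding S\<^sub>B_def by blast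
  obtain M\<^sub>A where M\<^sub>A: "0 \<le> M\<^sub>A" "\<And>x h. x \<in> K \<Longrightarrow> norm (DA x h) \<le> M\<^sub>A * norm h"
    using derivative_bound_compact[OF K(1), of DA] K(2) dA has_derivative_linear
      continuous_on_subset[OF cDA K(2)] by blast
  obtain M\<^sub>B where M\<^sub>B: "0 \<le> M\<^sub>B" "\<And>x h. x \<in> K \<Longrightarrow> norm (DB x h) \<le> M\<^sub>B * norm h"
    using derivative_bound_compact[OF K(1), of DB] K(2) dB has_derivative_linear
      continuous_on_subset[OF cDB K(2)] by blast
  define M where "M = max M\<^sub>A M\<^sub>B"
  have "0 \<le> M" using M\<^sub>A by (simp add: M_def)
  moreover have "norm (DA x h) \<le> M * norm h" "norm (DB x h) \<le> M * norm h" if "x \<in> K" for x h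
    using M\<^sub>A(2)[OF that, of h] M\<^sub>B(2)[OF that, of h] mult_right_mono[of M\<^sub>A M "norm h"]
      mult_right_mono[of M\<^sub>B M "norm h"] by (auto simp: M_def)
  ultimately have M: "0 \<le> M" "\<And>x h. x \<in> K \<Longrightarrow> norm (DA x h) \<le> M * norm h"
    "\<And>x h. x \<in> K \<Longrightarrow> norm (DB x h) \<le> M * norm h"
    by blast+
  have "continuous_on K (\<lambda>x. ramp_sq (w x - e))"
    unfolding ramp_sq_def by (intro continuous_intros continuous_on_subset[OF cw K(2)])
  then have "bounded ((\<lambda>x. ramp_sq (w x - e)) ` K)"
    using K by (intro compact_imp_bounded compact_continuous_image)
  then obtain \<Phi> where \<Phi>: "0 < \<Phi>" "\<And>x. x \<in> K \<Longrightarrow> \<bar>ramp_sq (w x - e)\<bar> \<le> \<Phi>"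
    unfolding bounded_pos by auto

  define \<theta> where "\<theta> x = 2 * max 0 (w x - e) * ((A x - B x) \<bullet> (sgn (A x) - sgn (B x)))" for x
  define c where "c = \<theta> p / 2"
  define \<eta> where "\<eta> = min (norm (A p)) (norm (B p)) / 2"
  have "0 < norm (A p)" "0 < norm (B p)" using p by auto
  then have \<eta>: "0 < \<eta>" "\<eta> < norm (A p)" "\<eta> < norm (B p)"
    unfolding \<eta>_def by linarith+
  have "0 < \<theta> p"
    using p e neq by (auto simp: \<theta>_def inner_diff_sgn intro!: mult_pos_pos add_pos_pos)
  then have c: "0 < c" "c < \<theta> p" by (auto simp: c_def)
  have isCont: "isCont A p" "isCont B p" "isCont w p"
    using cA cB cw p(1) open_\<Omega> by (simp_all add: continuous_on_eq_continuous_at)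
  have "isCont \<theta> p"
    unfolding \<theta>_def using isCont p by (intro continuous_intros isCont_sgn) auto
  then have "\<forall>\<^sub>F x in at p. c < \<theta> x \<and> e < w x \<and> \<eta> < norm (A x) \<and> \<eta> < norm (B x) \<and> x \<in> \<Omega>"
    using isCont isCont_norm[OF isCont(1)] isCont_norm[OF isCont(2)] c e \<eta> open_\<Omega> p(1)
    unfolding isCont_def
    by (intro eventually_conj) (auto intro: order_tendstoD eventually_at_in_open')
  then obtain \<rho> where \<rho>: "0 < \<rho>" and "\<forall>x. x \<noteq> p \<and> dist x p < \<rho> \<longrightarrow>
      c < \<theta> x \<and> e < w x \<and> \<eta> < norm (A x) \<and> \<eta> < norm (B x) \<and> x \<in> \<Omega>"
    unfolding eventually_at by auto
  then have ball: "c < \<theta> x \<and> e < w x \<and> \<eta> < norm (A x) \<and> \<eta> < norm (B x) \<and> x \<in> \<Omega>"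
    if "x \<in> ball p \<rho>" for x
    using that c e \<eta> p(1) by (cases "x = p") (auto simp: dist_commute)
  define m where "m = measure lebesgue (ball p \<rho>)"
  have m: "0 < m" using content_ball_pos[OF \<rho>, of p] by (simp add: m_def)

  have est: "c * m \<le> \<Phi> * 64 * M * (C\<^sub>A + C\<^sub>B) * \<delta>" if \<delta>: "0 < \<delta>" "\<delta> \<le> 1" "\<delta> \<le> \<eta>" for \<delta>
  proof -
    define E where "E = \<Phi> * (64 * M / \<delta>)"
    have E: "0 \<le> E" using \<Phi> M \<delta> by (simp add: E_def)
    have cut1: "cutoff (4 / \<delta>\<^sup>2 * (a \<bullet> a)) = 1" if "\<eta> < norm a" for a :: 'a
    proof (rule cutoff_eq_1)
      have "\<delta>\<^sup>2 \<le> (norm a)\<^sup>2" using that \<delta> by (intro power_mono) auto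
      moreover have "0 \<le> (norm a)\<^sup>2" by simp
      ultimately have "2 * \<delta>\<^sup>2 \<le> 4 * (norm a)\<^sup>2" by linarith
      then show "2 \<le> 4 / \<delta>\<^sup>2 * (a \<bullet> a)"
        using \<delta> by (simp add: power2_norm_eq_inner field_simps)
    qed
    obtain F where F: "has_bochner_integral lborel F 0" "\<And>x. x \<notin> K \<Longrightarrow> F x = 0"
      "\<And>x. x \<in> K \<Longrightarrow> \<theta> x * cutoff (4 / \<delta>\<^sup>2 * (A x \<bullet> A x)) * cutoff (4 / \<delta>\<^sup>2 * (B x \<bullet> B x))
        - E * (of_bool (norm (A x) < \<delta>) + of_bool (norm (B x) < \<delta>)) \<le> F x"
      using flux_inequality[OF e(1) \<delta>(1) M(1), of \<Phi>] M(2,3) \<Phi>(2) unfolding K_def \<theta>_def E_def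
      by fastforce
    \<comment> \<open>The sublevel sets are Lebesgue measurable sets, so the flux integral is moved
      to the completed measure.\<close>
    have F': "has_bochner_integral lebesgue F 0"
      using F(1) by (auto simp: has_bochner_integral_iff integrable_completion integral_completion
          dest: borel_measurable_integrable)
    \<comment> \<open>An explicit minorant of \<open>F\<close>: its integral is computed from
      measures, while that of \<open>F\<close> is 0.\<close>
    define L where "L x = c * indicator (ball p \<rho>) x
      - E * (indicator (S\<^sub>A \<delta>) x + indicator (S\<^sub>B \<delta>) x)" for x
    have ind: "has_bochner_integral lebesgue (indicator S) (measure lebesgue S)"
      if "S \<in> lmeasurable" for S :: "'a set"
      using that unfolding fmeasurable_def by (intro has_bochner_integral_real_indicator) blast+
    have "has_bochner_integral lebesgue L
        (c * m - E * (measure lebesgue (S\<^sub>A \<delta>) + measure lebesgue (S\<^sub>B \<delta>)))"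
      unfolding L_def m_def using C\<^sub>A(2)[OF \<delta>(1,2)] C\<^sub>B(2)[OF \<delta>(1,2)]
      by (intro has_bochner_integral_diff has_bochner_integral_mult_right has_bochner_integral_add
          ind lmeasurable_ball)
    moreover have "L x \<le> F x" for x
    proof (cases "x \<in> K")
      case False
      then have "x \<notin> ball p \<rho>" using ball[of x] by (auto simp: K_def)
      then show ?thesis using False F(2) by (simp add: L_def S\<^sub>A_def S\<^sub>B_def)
    next
      case True
      have "c * indicator (ball p \<rho>) x
          \<le> \<theta> x * cutoff (4 / \<delta>\<^sup>2 * (A x \<bullet> A x)) * cutoff (4 / \<delta>\<^sup>2 * (B x \<bullet> B x))"
      proof (cases "x \<in> ball p \<rho>")
        case True
        then show ?thesis using ball[OF True] cut1 by simp
      next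
        case False
        then show ?thesis using cutoff_bounds by (simp add: \<theta>_def inner_diff_sgn_nonneg)
      qed
      with F(3)[OF True] show ?thesis using True by (simp add: L_def S\<^sub>A_def S\<^sub>B_def indicator_def of_bool_def)
    qed
    ultimately have "c * m - E * (measure lebesgue (S\<^sub>A \<delta>) + measure lebesgue (S\<^sub>B \<delta>)) \<le> 0"
      using F' integral_mono[of lebesgue L F] by (auto simp: has_bochner_integral_iff)
    moreover have "E * (measure lebesgue (S\<^sub>A \<delta>) + measure lebesgue (S\<^sub>B \<delta>)) \<le> E * (C\<^sub>A * \<delta>\<^sup>2 + C\<^sub>B * \<delta>\<^sup>2)"
      using E C\<^sub>A(3)[OF \<delta>(1,2)] C\<^sub>B(3)[OF \<delta>(1,2)] by (intro mult_left_mono add_mono)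
    moreover have "E * (C\<^sub>A * \<delta>\<^sup>2 + C\<^sub>B * \<delta>\<^sup>2) = \<Phi> * 64 * M * (C\<^sub>A + C\<^sub>B) * \<delta>"
      using \<delta> by (simp add: E_def field_simps power2_eq_square)
    ultimately show ?thesis by linarith
  qed
  define Q where "Q = \<Phi> * 64 * M * (C\<^sub>A + C\<^sub>B)"
  have Q: "0 \<le> Q" using \<Phi> M C\<^sub>A C\<^sub>B by (simp add: Q_def)
  \<comment> \<open>Chosen so that \<open>Q * \<delta>\<close> is at most \<open>c * m / 2\<close>;
    \<open>Q + 1\<close> guards against division by 0.\<close>
  define \<delta> where "\<delta> = min (min 1 \<eta>) (c * m / (2 * (Q + 1)))"
  have \<delta>: "0 < \<delta>" "\<delta> \<le> 1" "\<delta> \<le> \<eta>" "\<delta> \<le> c * m / (2 * (Q + 1))"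
    using \<eta> c m Q by (auto simp: \<delta>_def)
  have "c * m \<le> Q * \<delta>" using est[OF \<delta>(1-3)] by (simp add: Q_def)
  also have "\<dots> \<le> (Q + 1) * (c * m / (2 * (Q + 1)))" using \<delta> Q by (intro mult_mono) auto
  also have "\<dots> = c * m / 2" using Q by (simp add: field_simps)
  finally show False using c m by (simp add: mult_pos_pos)
qed

end

section \<open>From parallel fields to the comparison principle\<close>

text \<open>A field vanishing on an open set has zero derivative there, against the rank bound. So
  zero sets have empty interior.\<close>

lemma rank_two_nonzero_dense:
  fixes A :: "'a::euclidean_space \<Rightarrow> 'b::euclidean_space"
  assumes U: "open U" "x \<in> U" and A: "\<And>x. x \<in> U \<Longrightarrow> (A has_derivative D x) (at x)"
    and rank: "\<And>x. x \<in> U \<Longrightarrow> \<exists>a b. \<forall>s t. D x (s *\<^sub>R a + t *\<^sub>R b) = 0 \<longrightarrow> s = 0 \<and> t = 0"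
  shows "\<exists>y\<in>U. A y \<noteq> 0"
proof (rule ccontr)
  assume "\<not> ?thesis"
  then have "((\<lambda>x. 0) has_derivative D x) (at x)"
    using has_derivative_transform_within_open[OF A[OF U(2)] U] by auto
  then have "D x = (\<lambda>h. 0)" using has_derivative_unique has_derivative_const by blast
  then show False using rank[OF U(2)] by (metis zero_neq_one)
qed

text \<open>The ratio \<open>c\<close> of the norms is differentiable since neither norm vanishes.
  Differentiating \<open>B = c A\<close> multiplies the skew part by \<open>c p\<close> and adds a
  decomposable form; as the two skew parts coincide, \<open>Ffield_not_decomposable\<close> yields
  \<open>c p = 1\<close>.\<close>

lemma parallel_fields_eq:
  fixes A B :: "(real^'m) \<times> (real^'m) \<Rightarrow> (real^'m) \<times> (real^'m)"
  assumes card: "CARD('m) \<ge> 2" and U: "open U" "p \<in> U"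
    and A: "(A has_derivative DA) (at p)" and B: "(B has_derivative DB) (at p)"
    and skewA: "\<And>h k. DA h \<bullet> k - DA k \<bullet> h = 2 * (Ffield h \<bullet> k)"
    and skewB: "\<And>h k. DB h \<bullet> k - DB k \<bullet> h = 2 * (Ffield h \<bullet> k)"
    and par: "\<And>x. x \<in> U \<Longrightarrow> A x \<noteq> 0 \<and> B x \<noteq> 0 \<and> sgn (A x) = sgn (B x)"
  shows "A p = B p"
proof -
  define c where "c x = norm (B x) / norm (A x)" for x
  have Bc: "c x *\<^sub>R A x = B x" if "x \<in> U" for x
  proof -
    have "c x *\<^sub>R A x = norm (B x) *\<^sub>R sgn (A x)" by (simp add: c_def sgn_div_norm divide_inverse)
    also have "\<dots> = B x" using par[OF that] by (simp add: sgn_div_norm)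
    finally show ?thesis .
  qed
  have "(\<lambda>x. norm (A x)) differentiable (at p)" "(\<lambda>x. norm (B x)) differentiable (at p)"
    using has_derivative_compose[OF A has_derivative_norm] has_derivative_compose[OF B has_derivative_norm]
      par[OF U(2)] by (auto simp: differentiable_def)
  then have "c differentiable (at p)"
    unfolding c_def using par[OF U(2)] by (intro differentiable_divide) auto
  then obtain c' where c': "(c has_derivative c') (at p)" by (auto simp: differentiable_def)
  have "(B has_derivative (\<lambda>h. c p *\<^sub>R DA h + c' h *\<^sub>R A p)) (at p)"
    by (rule has_derivative_transform_within_open[OF has_derivative_scaleR[OF c' A] U Bc])
  then have DB: "DB = (\<lambda>h. c p *\<^sub>R DA h + c' h *\<^sub>R A p)" using B has_derivative_unique by blast
  have "2 * (1 - c p) * (Ffield h \<bullet> k) = c' h * (A p \<bullet> k) - c' k * (A p \<bullet> h)" for h k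
  proof -
    have "2 * (Ffield h \<bullet> k) = c p * (DA h \<bullet> k - DA k \<bullet> h) + (c' h * (A p \<bullet> k) - c' k * (A p \<bullet> h))"
      unfolding skewB[symmetric] DB by (simp add: inner_add_left algebra_simps)
    then show ?thesis unfolding skewA by (simp add: algebra_simps)
  qed
  from Ffield_not_decomposable[OF card has_derivative_linear[OF c'] this] have "c p = 1" by simp
  then show ?thesis using Bc[OF U(2)] by simp
qed

text \<open>The set \<open>T\<close> where \<open>w\<close> attains its maximum over a positive
  superlevel set is compact. It is open because \<open>w\<close> is constant on balls inside the
  positive set. A nonempty clopen subset of a Euclidean space is the whole space, which is not
  compact.\<close>

lemma no_positive_critical_set:
  fixes w :: "'a::euclidean_space \<Rightarrow> real"
  assumes \<Omega>: "open \<Omega>" and cw: "continuous_on \<Omega> w"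
    and K: "\<And>e. 0 < e \<Longrightarrow> compact {x\<in>\<Omega>. e \<le> w x}"
    and crit: "\<And>x. x \<in> \<Omega> \<Longrightarrow> 0 < w x \<Longrightarrow> (w has_derivative (\<lambda>h. 0)) (at x)"
    and p: "p \<in> \<Omega>"
  shows "w p \<le> 0"
proof (rule ccontr)
  assume "\<not> w p \<le> 0"
  then have wp: "0 < w p" by simp
  define K where "K = {x\<in>\<Omega>. w p \<le> w x}"
  have compK: "compact K" "p \<in> K" "K \<subseteq> \<Omega>" using K[OF wp] p by (auto simp: K_def)
  obtain q where q: "q \<in> K" "\<And>x. x \<in> K \<Longrightarrow> w x \<le> w q"
    using continuous_attains_sup[of K w] compK continuous_on_subset[OF cw] by blast
  define T where "T = {x\<in>\<Omega>. w q \<le> w x}"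
  have wq: "0 < w q" using q(1) wp by (auto simp: K_def)
  have T_eq: "w x = w q" if "x \<in> T" for x
    using q that q(2)[of x] by (force simp: T_def K_def)
  have "compact T" unfolding T_def using K wq by blast
  moreover have "open T"
  proof (subst open_contains_ball, intro ballI)
    fix x assume x: "x \<in> T"
    have "open {y\<in>\<Omega>. 0 < w y}"
      using continuous_open_preimage[OF cw \<Omega>, of "{0<..}"] by (simp add: vimage_def Int_def)
    then obtain r where r: "0 < r" "ball x r \<subseteq> {y\<in>\<Omega>. 0 < w y}"
      using x wq by (auto simp: open_contains_ball T_def)
    have "\<exists>c. \<forall>y\<in>ball x r. w y = c"
    proof (rule has_derivative_zero_constant)
      fix y assume "y \<in> ball x r"
      then have "y \<in> \<Omega>" "0 < w y" using r(2) by auto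
      then show "(w has_derivative (\<lambda>h. 0)) (at y within ball x r)"
        by (rule has_derivative_at_withinI[OF crit])
    qed simp
    then have "w y = w x" if "y \<in> ball x r" for y
      using that r(1) by (metis centre_in_ball)
    then show "\<exists>r>0. ball x r \<subseteq> T" using r T_eq[OF x] by (intro exI[of _ r]) (auto simp: T_def)
  qed
  moreover have "q \<in> T" using q(1) compK(3) by (auto simp: T_def)
  ultimately have "T = UNIV" using clopen[of T] compact_imp_closed by blast
  then show False using \<open>compact T\<close> by (simp add: not_compact_UNIV)
qed

text \<open>\<open>Nfield\<close> is \<open>sgn\<close> of the field, so the divergence hypothesis
  takes the form of \<open>div_le\<close>.\<close>

lemma divergence_Nfield:
  assumes "((\<lambda>p. grad w p + Ffield p) has_derivative D) (at p)" "grad w p + Ffield p \<noteq> 0"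
  shows "divergence (Nfield w) p = (\<Sum>b\<in>Basis. sgn_deriv (grad w p + Ffield p) (D b) \<bullet> b)"
proof -
  have "((\<lambda>q. Nfield w q \<bullet> b) has_derivative (\<lambda>h. sgn_deriv (grad w p + Ffield p) (D h) \<bullet> b)) (at p)" for b
    using has_derivative_inner_left[OF has_derivative_sgn[OF assms]]
    by (simp add: Nfield_def[abs_def] sgn_div_norm)
  from frechet_derivative_at[OF this, symmetric] show ?thesis by (simp add: divergence_def)
qed

theorem theoremC:
  fixes \<Omega> :: "((real^'m) \<times> (real^'m)) set"
    and u v :: "(real^'m) \<times> (real^'m) \<Rightarrow> real"
  assumes "CARD('m) \<ge> 2"
    and "open \<Omega>" "connected \<Omega>" "\<Omega> \<noteq> {}" "bounded \<Omega>"
    and "C2_on \<Omega> u" "C2_on \<Omega> v"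
    and "continuous_on (closure \<Omega>) u" "continuous_on (closure \<Omega>) v"
    and "\<forall>p\<in>\<Omega> - (Sset \<Omega> u \<union> Sset \<Omega> v).
           divergence (Nfield u) p \<ge> divergence (Nfield v) p"
    and "\<forall>p\<in>frontier \<Omega>. u p \<le> v p"
  shows "\<forall>p\<in>\<Omega>. u p \<le> v p"
proof -
  note card = assms(1) and \<Omega> = assms(2)
  define w where "w p = u p - v p" for p
  define A where "A p = grad u p + Ffield p" for p
  define B where "B p = grad v p + Ffield p" for p
  obtain DA where "\<forall>p\<in>\<Omega>. (A has_derivative DA p) (at p)"
    "\<forall>h. continuous_on \<Omega> (\<lambda>p. DA p h)"
    "\<forall>p\<in>\<Omega>. \<forall>h k. DA p h \<bullet> k - DA p k \<bullet> h = 2 * (Ffield h \<bullet> k)"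
    using C2_on_grad_plus_Ffield[OF \<Omega> assms(6), folded A_def] by (elim exE conjE)
  then have DA: "\<And>p. p \<in> \<Omega> \<Longrightarrow> (A has_derivative DA p) (at p)"
    "\<And>h. continuous_on \<Omega> (\<lambda>p. DA p h)"
    "\<And>p h k. p \<in> \<Omega> \<Longrightarrow> DA p h \<bullet> k - DA p k \<bullet> h = 2 * (Ffield h \<bullet> k)"
    by blast+
  obtain DB where "\<forall>p\<in>\<Omega>. (B has_derivative DB p) (at p)"
    "\<forall>h. continuous_on \<Omega> (\<lambda>p. DB p h)"
    "\<forall>p\<in>\<Omega>. \<forall>h k. DB p h \<bullet> k - DB p k \<bullet> h = 2 * (Ffield h \<bullet> k)"
    using C2_on_grad_plus_Ffield[OF \<Omega> assms(7), folded B_def] by (elim exE conjE)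
  then have DB: "\<And>p. p \<in> \<Omega> \<Longrightarrow> (B has_derivative DB p) (at p)"
    "\<And>h. continuous_on \<Omega> (\<lambda>p. DB p h)"
    "\<And>p h k. p \<in> \<Omega> \<Longrightarrow> DB p h \<bullet> k - DB p k \<bullet> h = 2 * (Ffield h \<bullet> k)"
    by blast+
  interpret comparison \<Omega> w A B DA DB
  proof
    show "compact {x\<in>\<Omega>. e \<le> w x}" if "0 < e" for e
    proof -
      \<comment> \<open>Compactness is clear in the closure of the bounded domain; the boundary
        inequality keeps the set off the frontier, hence inside \<open>\<Omega>\<close>.\<close>
      have "compact {x\<in>closure \<Omega>. e \<le> w x}"
        unfolding w_def using assms(5,8,9)
        by (intro compact_superlevel continuous_intros) (auto simp: compact_closure)
      also have "{x\<in>closure \<Omega>. e \<le> w x} = {x\<in>\<Omega>. e \<le> w x}"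
      proof -
        have "x \<in> \<Omega>" if "x \<in> closure \<Omega>" "e \<le> w x" for x
          using that \<open>0 < e\<close> assms(11) \<Omega> by (force simp: frontier_def interior_open w_def)
        then show ?thesis using closure_subset by blast
      qed
      finally show ?thesis .
    qed
    show "(w has_derivative (\<lambda>h. (A x - B x) \<bullet> h)) (at x)" if "x \<in> \<Omega>" for x
    proof -
      have "u differentiable (at x)" "v differentiable (at x)"
        using assms(6,7) that by (auto simp: C2_on_def C1_on_def)
      from has_derivative_diff[OF this[THEN grad_has_derivative]] show ?thesis
        by (simp add: w_def[abs_def] A_def B_def inner_diff_left)
    qed
    show "(\<Sum>b\<in>Basis. sgn_deriv (B x) (DB x b) \<bullet> b) \<le> (\<Sum>b\<in>Basis. sgn_deriv (A x) (DA x b) \<bullet> b)"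
      if x: "x \<in> \<Omega>" "A x \<noteq> 0" "B x \<noteq> 0" for x
    proof -
      have "divergence (Nfield u) x = (\<Sum>b\<in>Basis. sgn_deriv (A x) (DA x b) \<bullet> b)"
        by (rule divergence_Nfield[of u "DA x" x, folded A_def, OF DA(1)[OF x(1)] x(2)])
      moreover have "divergence (Nfield v) x = (\<Sum>b\<in>Basis. sgn_deriv (B x) (DB x b) \<bullet> b)"
        by (rule divergence_Nfield[of v "DB x" x, folded B_def, OF DB(1)[OF x(1)] x(3)])
      moreover have "x \<in> \<Omega> - (Sset \<Omega> u \<union> Sset \<Omega> v)"
        using x by (simp add: Sset_def A_def B_def)
      ultimately show ?thesis using assms(10) by metis
    qed
    show "\<exists>a b. \<forall>s t. DA x (s *\<^sub>R a + t *\<^sub>R b) = 0 \<longrightarrow> s = 0 \<and> t = 0" if "x \<in> \<Omega>" for x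
      using skew_part_Ffield_rank_two[OF card has_derivative_linear[OF DA(1)[OF that]] DA(3)[OF that]] .
    show "\<exists>a b. \<forall>s t. DB x (s *\<^sub>R a + t *\<^sub>R b) = 0 \<longrightarrow> s = 0 \<and> t = 0" if "x \<in> \<Omega>" for x
      using skew_part_Ffield_rank_two[OF card has_derivative_linear[OF DB(1)[OF that]] DB(3)[OF that]] .
  qed (blast intro: \<Omega> DA(1) DB(1) DA(2) DB(2))+
  define W where "W = {x\<in>\<Omega>. 0 < w x}"
  have openW: "open W"
    using continuous_open_preimage[OF cw \<Omega>, of "{0<..}"] by (simp add: W_def vimage_def Int_def)
  have open_ne: "open {x\<in>V. f x \<noteq> g x}" if "open V" "continuous_on V f" "continuous_on V g"
    for V and f g :: "(real^'m) \<times> (real^'m) \<Rightarrow> (real^'m) \<times> (real^'m)"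
  proof -
    have "open (V \<inter> (\<lambda>x. f x - g x) -` (- {0}))"
      using that by (intro continuous_open_preimage continuous_intros) auto
    then show ?thesis by (simp add: vimage_def Int_def)
  qed
  have AB: "A x = B x" if "x \<in> W" for x
  proof (rule ccontr)
    assume ne: "A x \<noteq> B x"
    have cont: "continuous_on V A" "continuous_on V B" if "V \<subseteq> W" for V
      using that cA cB by (auto simp: W_def intro: continuous_on_subset)
    \<comment> \<open>\<open>sgn_eq\<close> speaks only of points where neither field vanishes.
      Restricting to nonzero \<open>A\<close>, then to nonzero \<open>B\<close>, keeps the set open
      and, by density, nonempty; at a remaining point the fields are parallel nearby, hence
      equal.\<close>
    define V where "V = {x\<in>W. A x \<noteq> B x}"
    have V: "open V" "V \<subseteq> W" unfolding V_def using openW cont by (auto intro: open_ne)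
    define V' where "V' = {x\<in>V. A x \<noteq> 0}"
    have V': "open V'" unfolding V'_def using V cont by (intro open_ne) auto
    define V'' where "V'' = {x\<in>V'. B x \<noteq> 0}"
    have V'': "open V''" unfolding V''_def using V V' cont[of V'] by (intro open_ne) (auto simp: V'_def)
    have sub: "V'' \<subseteq> V'" "V' \<subseteq> V" "V \<subseteq> \<Omega>" using V(2) by (auto simp: V'_def V''_def W_def)
    have "\<exists>y\<in>V. A y \<noteq> 0"
    proof (rule rank_two_nonzero_dense[OF V(1)])
      show "x \<in> V" using that ne by (simp add: V_def)
    qed (use dA rankA sub in blast)+
    then obtain y where "y \<in> V'" by (auto simp: V'_def)
    then have "\<exists>z\<in>V'. B z \<noteq> 0"
      by (rule rank_two_nonzero_dense[OF V']) (use dB rankB sub in blast)+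
    then obtain z where z: "z \<in> V''" by (auto simp: V''_def)
    have par: "A t \<noteq> 0 \<and> B t \<noteq> 0 \<and> sgn (A t) = sgn (B t)" if "t \<in> V''" for t
      using that sgn_eq[of t] by (auto simp: V''_def V'_def V_def W_def)
    have "z \<in> \<Omega>" using z sub by auto
    from parallel_fields_eq[OF card V'' z dA[OF this] dB[OF this] DA(3)[OF this] DB(3)[OF this] par]
    show False using z by (auto simp: V''_def V'_def V_def)
  qed
  have "w p \<le> 0" if "p \<in> \<Omega>" for p
  proof (rule no_positive_critical_set[OF \<Omega> cw compact_K _ that])
    fix x assume "x \<in> \<Omega>" "0 < w x"
    then show "(w has_derivative (\<lambda>h. 0)) (at x)" using dw[of x] AB[of x] by (simp add: W_def)
  qed
  then show ?thesis by (simp add: w_def)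
qed

end
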